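(* Let $n\ge 1$ and let $g$ be the Semi-Riemannian metric on $GL_n=GL_n(\mathbb{R})$ given by $g_A(V,W)=\mathrm{tr}(A^{-1}VA^{-1}W)$ for $A\in GL_n$, $V,W\in T_A(GL_n)=M_n(\mathbb{R})$. Let $K_0,K_1\in GL_n$. 1) There exists a geodesic arc of $(GL_n,g)$ joining $K_0$ and $K_1$ if and only if each elementary divisor (Jordan block) of $K_0^{-1}K_1$ belonging to any (possible) negative eigenvalue occurs an even number of times. Moreover the geodesic arc is unique if and only if all the eigenvalues of $K_0^{-1}K_1$ are positive real and no elementary divisor (Jordan block) of $K_0^{-1}K_1$ belonging to any eigenvalue appears more than once. 2) Assume that there is more than one geodesic arc of $(GL_n,g)$ joining $K_0$ and $K_1$. Then there are infinitely many such geodesic arcs, and the set of them is (a) countable if $K_0^{-1}K_1$ has complex (non-real) eigenvalues, none of which belongs to more than one Jordan block, and all (possible) real eigenvalues of $K_0^{-1}K_1$ are positive and such that their Jordan blocks appear only once; (b) uncountable (more precisely, of the cardinality of the continuum) if $K_0^{-1}K_1$ has some negative real eigenvalue, or if it has some positive real eigenvalue belonging to Jordan blocks that appear more than once, or if it has some complex conjugate (non-real) eigenvalues belonging to more than one Jordan block.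
   Context: A geodesic arc joining $K_0$ and $K_1$ is any geodesic $\gamma:[0,1]\to GL_n$ of $(GL_n,g)$ with $\gamma(0)=K_0$, $\gamma(1)=K_1$ (constant curves are regarded as geodesics). Jordan blocks refer to the complex Jordan form; a Jordan block $J_k(\lambda)$ is identified by its eigenvalue $\lambda$ and its size $k$, and the number of times it occurs is its multiplicity in the Jordan form. Thus "no Jordan block belonging to an eigenvalue appears more than once" allows several blocks of different sizes with the same eigenvalue, whereas "an eigenvalue belongs to more than one Jordan block" means that there are at least two Jordan blocks (of equal or different sizes) with that eigenvalue. *)

theory Defs
  imports
    "HOL-Analysis.Analysis"
    "HOL-Library.Equipollence"
    "HOL-Library.Multiset"
    "Jordan_Normal_Form.Jordan_Normal_Form_Existence"
    "Jordan_Normal_Form.Jordan_Normal_Form_Uniqueness"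
begin

section \<open>Geodesics of a Semi-Riemannian metric on an open subset of a Euclidean space\<close>

text \<open>
  A metric on an open subset of \<open>'a\<close> is a field \<open>G p u v\<close> of bilinear forms, where \<open>u\<close>, \<open>v\<close> are
  tangent vectors at \<open>p\<close>. The Levi-Civita connection in the global chart is given by the
  Christoffel symbols; since the chart is the whole space, they are evaluated on
  arbitrary constant vector fields \<open>u\<close>, \<open>v\<close>, \<open>w\<close> (Koszul formula without bracket terms).
\<close>

definition christoffel_first ::
    "('a::euclidean_space \<Rightarrow> 'a \<Rightarrow> 'a \<Rightarrow> real) \<Rightarrow> 'a \<Rightarrow> 'a \<Rightarrow> 'a \<Rightarrow> 'a \<Rightarrow> real" where
  "christoffel_first G p u v w =
     (frechet_derivative (\<lambda>q. G q v w) (at p) u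
      + frechet_derivative (\<lambda>q. G q u w) (at p) v
      - frechet_derivative (\<lambda>q. G q u v) (at p) w) / 2"

text \<open>Raising the index is possible, and \<open>THE\<close> meaningful, because the metric is nondegenerate.\<close>

definition christoffel ::
    "('a::euclidean_space \<Rightarrow> 'a \<Rightarrow> 'a \<Rightarrow> real) \<Rightarrow> 'a \<Rightarrow> 'a \<Rightarrow> 'a \<Rightarrow> 'a" where
  "christoffel G p u v = (THE x. \<forall>w. G p x w = christoffel_first G p u v w)"

text \<open>
  A geodesic is a smooth curve whose velocity is parallel along it. \<open>D k\<close> is the \<open>k\<close>-th derivative
  of \<open>\<gamma>\<close> on \<open>I\<close>, one-sided at end points belonging to \<open>I\<close>.
\<close>

definition geodesic_on ::
    "('a::euclidean_space \<Rightarrow> 'a \<Rightarrow> 'a \<Rightarrow> real) \<Rightarrow> 'a set \<Rightarrow> real set \<Rightarrow> (real \<Rightarrow> 'a) \<Rightarrow> bool" where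
  "geodesic_on G U I \<gamma> \<longleftrightarrow>
     \<gamma> ` I \<subseteq> U \<and>
     (\<exists>D :: nat \<Rightarrow> real \<Rightarrow> 'a. D 0 = \<gamma> \<and>
        (\<forall>k. \<forall>t\<in>I. (D k has_vector_derivative D (Suc k) t) (at t within I)) \<and>
        (\<forall>t\<in>I. D 2 t + christoffel G (\<gamma> t) (D 1 t) (D 1 t) = 0))"

section \<open>The general linear group with its trace metric\<close>

definition GL :: "(real^'n^'n) set" where
  "GL = {A. invertible A}"

definition gl_metric :: "real^'n^'n \<Rightarrow> real^'n^'n \<Rightarrow> real^'n^'n \<Rightarrow> real" where
  "gl_metric A V W = trace (matrix_inv A ** V ** matrix_inv A ** W)"

text \<open>
  Arcs are maps with domain \<open>[0,1]\<close>; extensionality fixes the values outside the domain, so that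
  arcs are counted correctly.
\<close>

definition geodesic_arcs :: "real^'n^'n \<Rightarrow> real^'n^'n \<Rightarrow> (real \<Rightarrow> real^'n^'n) set" where
  "geodesic_arcs K0 K1 =
     {\<gamma> \<in> extensional {0..1}. geodesic_on gl_metric GL {0..1} \<gamma> \<and> \<gamma> 0 = K0 \<and> \<gamma> 1 = K1}"

section \<open>Complex Jordan blocks\<close>

text \<open>
  The index type is enumerated by \<^term>\<open>from_nat_into UNIV\<close>, a bijection from
  \<open>{..<CARD('n)}\<close>; another enumeration yields a similar matrix.
\<close>

definition complex_mat :: "real^'n^'n \<Rightarrow> complex mat" where
  "complex_mat A = Matrix.mat CARD('n) CARD('n)
     (\<lambda>(i, j). complex_of_real
        (vec_nth (vec_nth A (from_nat_into UNIV i)) (from_nat_into UNIV j)))"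

text \<open>
  The multiset of the blocks \<open>(k, ev)\<close>, of size \<open>k\<close> with eigenvalue \<open>ev\<close>, of the
  Jordan form. It does not depend on the choice of a Jordan form, as shown below.
\<close>

definition jordan_blocks :: "complex mat \<Rightarrow> (nat \<times> complex) multiset" where
  "jordan_blocks A = mset (SOME bs. jordan_nf A bs)"

definition jordan_multiplicity :: "complex mat \<Rightarrow> nat \<Rightarrow> complex \<Rightarrow> nat" where
  "jordan_multiplicity A k ev = count (jordan_blocks A) (k, ev)"

definition num_jordan_blocks :: "complex mat \<Rightarrow> complex \<Rightarrow> nat" where
  "num_jordan_blocks A ev = size {#b \<in># jordan_blocks A. snd b = ev#}"

lemma jordan_nf_complex_exists:
  fixes A :: "complex mat"
  assumes "A \<in> carrier_mat n n"
  shows "\<exists>bs. jordan_nf A bs"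
  using char_poly_factorized[OF assms] jordan_nf_exists[OF assms] by blast

lemma jordan_nf_mset_unique:
  fixes A :: "complex mat"
  assumes "jordan_nf A bs" "jordan_nf A cs"
  shows "mset bs = mset cs"
proof (rule multiset_eqI)
  fix b :: "nat \<times> complex"
  obtain k ev where b: "b = (k, ev)" by force
  show "count (mset bs) b = count (mset cs) b"
  proof (cases "k = 0")
    case True
    then have "b \<notin> set bs" "b \<notin> set cs"
      using assms b by (force simp: jordan_nf_def)+
    then show ?thesis by (metis count_mset_0_iff)
  next
    case False
    have "length (filter ((=) b) bs) = length (filter ((=) b) cs)"
      using compute_nr_of_jordan_blocks[OF assms(1) False, of ev]
        compute_nr_of_jordan_blocks[OF assms(2) False, of ev] b by simp
    then show ?thesis
      by (simp add: count_mset count_list_eq_length_filter)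
  qed
qed

lemma jordan_blocks_eq:
  assumes "jordan_nf A bs"
  shows "jordan_blocks A = mset bs"
  unfolding jordan_blocks_def
  by (rule jordan_nf_mset_unique[OF someI assms]) (rule assms)

end

theory Submission
  imports Defs
begin

text \<open>
  The geodesic equation is \<open>\<gamma>'' = \<gamma>' \<gamma>\<inverse> \<gamma>'\<close>, which says that \<open>\<gamma>\<inverse> \<gamma>'\<close> is constant. So the
  geodesics are the curves \<open>K\<^sub>0 exp (t X)\<close>, and the arcs from \<open>K\<^sub>0\<close> to \<open>K\<^sub>1\<close> correspond to the
  real logarithms \<open>X\<close> of \<open>A = K\<^sub>0\<inverse> K\<^sub>1\<close>, which are counted as in Culver's theorem.

  Exponentiation sends a Jordan block of size \<open>k\<close> for \<open>\<mu>\<close> to one of size \<open>k\<close> for \<open>exp \<mu>\<close>, and the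
  blocks of a real matrix are invariant under conjugation. Hence the blocks of \<open>A\<close> for a negative
  eigenvalue are paired. Conversely, every choice of logarithms of the eigenvalues of \<open>A\<close> that is
  invariant under conjugation is realised by a real matrix whose exponential is similar to \<open>A\<close>
  over the complex numbers, hence over the reals.

  If a real logarithm \<open>X\<close> has eigenvalues \<open>\<mu> \<noteq> \<nu>\<close> with \<open>exp \<mu> = exp \<nu>\<close>, then some real matrix
  commutes with \<open>A\<close> but not with \<open>X\<close>, and conjugating \<open>X\<close> yields a continuum of logarithms.
  Otherwise \<open>X\<close> is determined by \<open>A\<close> and the set of its eigenvalues: the entries of \<open>exp (t X)\<close>
  are exponential polynomials in \<open>t\<close> which are determined by their values at the natural numbers,
  that is, by the powers of \<open>A\<close>.
\<close>

section \<open>Exponentials of complex matrices and their Jordan forms\<close>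

text \<open>The cases are separated by one question: is \<open>exp\<close> injective on the spectrum
  of every real logarithm \<open>X\<close>? A negative eigenvalue of \<open>A\<close> has only
  nonreal logarithms, so a conjugate pair lies over it. Over a positive eigenvalue a collision costs
  two equal blocks of \<open>A\<close>, because a nonreal \<open>\<mu>\<close> comes with
  \<open>cnj \<mu>\<close> and blocks of the same sizes. Over a nonreal eigenvalue it costs two
  blocks of any sizes. Where the blocks allow a collision, one logarithm that has it suffices: its
  conjugates under matrices commuting with \<open>A\<close> already form a continuum, and the space
  of matrices has no more points. Where no collision is possible, a logarithm is determined by its
  spectrum, a finite set of logarithms of eigenvalues of \<open>A\<close>, so that there are
  countably many. The type \<open>complex mat\<close> mixes all dimensions, so the exponential is a
  relation there, with convergence required entry by entry; derivatives are taken on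
  \<open>real^'n^'n\<close>.\<close>

definition has_mexp :: "complex mat \<Rightarrow> complex \<Rightarrow> complex mat \<Rightarrow> bool" where
  "has_mexp A t E \<longleftrightarrow> dim_col A = dim_row A \<and> E \<in> carrier_mat (dim_row A) (dim_row A) \<and>
     (\<forall>i<dim_row A. \<forall>j<dim_row A. (\<lambda>k. (A ^\<^sub>m k) $$ (i, j) * t ^ k / fact k) sums (E $$ (i, j)))"

lemma has_mexpI:
  assumes "A \<in> carrier_mat n n" "E \<in> carrier_mat n n"
    and "\<And>i j. i < n \<Longrightarrow> j < n \<Longrightarrow> (\<lambda>k. (A ^\<^sub>m k) $$ (i, j) * t ^ k / fact k) sums (E $$ (i, j))"
  shows "has_mexp A t E"
  using assms unfolding has_mexp_def by auto

lemma has_mexpD: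
  assumes "has_mexp A t E" "A \<in> carrier_mat n n"
  shows "E \<in> carrier_mat n n"
    and "\<And>i j. i < n \<Longrightarrow> j < n \<Longrightarrow> (\<lambda>k. (A ^\<^sub>m k) $$ (i, j) * t ^ k / fact k) sums (E $$ (i, j))"
  using assms unfolding has_mexp_def by auto

lemma has_mexp_carrier:
  assumes "has_mexp A t E"
  obtains n where "A \<in> carrier_mat n n" "E \<in> carrier_mat n n"
  using assms unfolding has_mexp_def by (metis carrier_matI)

lemma has_mexp_unique:
  assumes "has_mexp A t E" "has_mexp A t F"
  shows "E = F"
proof -
  obtain n where A: "A \<in> carrier_mat n n" using has_mexp_carrier[OF assms(1)] by metis
  show ?thesis
    using has_mexpD[OF assms(1) A] has_mexpD[OF assms(2) A]
    by (intro eq_matI) (auto intro: sums_unique2[OF has_mexpD(2)[OF assms(1) A] has_mexpD(2)[OF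
        assms(2) A]])
qed

lemma mult_mat3_index:
  fixes P :: "'a::comm_semiring_0 mat"
  assumes "P \<in> carrier_mat n n" "M \<in> carrier_mat n n" "Q \<in> carrier_mat n n" "i < n" "j < n"
  shows "(P * M * Q) $$ (i, j) = (\<Sum>l<n. \<Sum>m<n. P $$ (i, m) * M $$ (m, l) * Q $$ (l, j))"
  using assms by (auto simp: scalar_prod_def sum_distrib_right atLeast0LessThan
      simp del: assoc_mult_mat intro!: sum.cong)

lemma has_mexp_similar:
  assumes B: "has_mexp B t E" and wit: "similar_mat_wit A B P Q"
  shows "has_mexp A t (P * E * Q)"
proof -
  define n where "n = dim_row A"
  note w = similar_mat_witD[OF n_def wit]
  note E = has_mexpD[OF B w(5)]
  show ?thesis
  proof (rule has_mexpI[OF w(4)])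
    show "P * E * Q \<in> carrier_mat n n" using w E(1) by auto
    fix i j assume ij: "i < n" "j < n"
    note expand = mult_mat3_index[OF w(6) _ w(7) ij]
    have "(\<lambda>k. \<Sum>l<n. \<Sum>m<n. P $$ (i, m) * ((B ^\<^sub>m k) $$ (m, l) * t ^ k / fact k) * Q $$ (l, j)) sums
        (\<Sum>l<n. \<Sum>m<n. P $$ (i, m) * E $$ (m, l) * Q $$ (l, j))"
      by (intro sums_sum sums_mult sums_mult2 E(2)) auto
    moreover have "(A ^\<^sub>m k) $$ (i, j) * t ^ k / fact k =
        (\<Sum>l<n. \<Sum>m<n. P $$ (i, m) * ((B ^\<^sub>m k) $$ (m, l) * t ^ k / fact k) * Q $$ (l, j))" for k
      unfolding similar_mat_wit_pow_id[OF wit] using expand[of "B ^\<^sub>m k"] w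
      by (simp add: sum_distrib_right sum_divide_distrib) (intro sum.cong refl, simp)
    ultimately show "(\<lambda>k. (A ^\<^sub>m k) $$ (i, j) * t ^ k / fact k) sums ((P * E * Q) $$ (i, j))"
      using expand[OF E(1)] by simp
  qed
qed

lemma has_mexp_four_block:
  assumes A: "A \<in> carrier_mat n n" and B: "B \<in> carrier_mat m m"
    and E: "has_mexp A t E" and F: "has_mexp B t F"
  shows "has_mexp (four_block_mat A (0\<^sub>m n m) (0\<^sub>m m n) B) t (four_block_mat E (0\<^sub>m n m) (0\<^sub>m m n) F)"
proof (rule has_mexpI[of _ "n + m"])
  note E' = has_mexpD[OF E A] and F' = has_mexpD[OF F B]
  show "four_block_mat A (0\<^sub>m n m) (0\<^sub>m m n) B \<in> carrier_mat (n + m) (n + m)"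
    "four_block_mat E (0\<^sub>m n m) (0\<^sub>m m n) F \<in> carrier_mat (n + m) (n + m)"
    using A B E'(1) F'(1) by auto
  fix i j assume ij: "i < n + m" "j < n + m"
  have dims: "dim_row (A ^\<^sub>m k) = n" "dim_col (A ^\<^sub>m k) = n" "dim_row (B ^\<^sub>m k) = m"
      "dim_col (B ^\<^sub>m k) = m" for k
    using A B by auto
  have dims': "dim_row E = n" "dim_col E = n" "dim_row F = m" "dim_col F = m"
    using E'(1) F'(1) by auto
  show "(\<lambda>k. (four_block_mat A (0\<^sub>m n m) (0\<^sub>m m n) B ^\<^sub>m k) $$ (i, j) * t ^ k / fact k)
      sums (four_block_mat E (0\<^sub>m n m) (0\<^sub>m m n) F $$ (i, j))"
    unfolding pow_four_block_mat[OF A B]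
    using ij E'(2)[of i j] F'(2)[of "i - n" "j - n"] dims dims'
    by (cases "i < n"; cases "j < n") simp_all
qed

text \<open>On the \<open>d\<close>-th superdiagonal the \<open>k\<close>-th power of the block has
  the entry \<open>k choose d\<close> times \<open>a ^ (k - d)\<close>. Division by
  \<open>fact k\<close> turns this into the exponential series of \<open>t * a\<close>, shifted by
  \<open>d\<close> places and multiplied by \<open>t ^ d / fact d\<close>.\<close>

lemma has_mexp_jordan_block:
  "has_mexp (jordan_block n a) t
     (Matrix.mat n n (\<lambda>(i, j). if i \<le> j then t ^ (j - i) / fact (j - i) * exp (t * a) else 0))"
proof (rule has_mexpI[of _ n])
  fix i j assume ij: "i < n" "j < n"
  show "(\<lambda>k. (jordan_block n a ^\<^sub>m k) $$ (i, j) * t ^ k / fact k) sums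
      (Matrix.mat n n (\<lambda>(i, j). if i \<le> j then t ^ (j - i) / fact (j - i) * exp (t * a) else 0) $$
          (i, j))"
  proof (cases "i \<le> j")
    case False
    then show ?thesis using ij by (simp add: jordan_block_pow)
  next
    case True
    define d where "d = j - i"
    define f where "f = (\<lambda>k. of_nat (k choose d) * a ^ (k - d) * t ^ k / fact k :: complex)"
    have "(\<lambda>k. (t * a) ^ k /\<^sub>R fact k) sums exp (t * a)" by (rule exp_converges)
    then have "(\<lambda>k. t ^ d / fact d * ((t * a) ^ k /\<^sub>R fact k)) sums (t ^ d / fact d * exp (t * a))"
      by (rule sums_mult)
    moreover have "t ^ d / fact d * ((t * a) ^ k /\<^sub>R fact k) = f (k + d)" for k
    proof -
      have "(of_nat ((k + d) choose d) :: complex) = fact (k + d) / (fact d * fact k)"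
        by (simp add: binomial_fact)
      then show ?thesis by (simp add: f_def scaleR_conv_of_real field_simps power_add)
    qed
    \<comment> \<open>For \<open>k < d\<close> the subtraction \<open>k - d\<close> truncates to 0,
      but the binomial coefficient vanishes.\<close>
    moreover have "(\<Sum>k<d. f k) = 0" by (intro sum.neutral) (simp add: f_def binomial_eq_0)
    ultimately have "f sums (t ^ d / fact d * exp (t * a))"
      using sums_iff_shift'[of f d "t ^ d / fact d * exp (t * a)"] by (simp add: sums_iff_shift)
    then show ?thesis using ij True
      by (simp add: jordan_block_pow f_def d_def)
  qed
qed auto

section \<open>Upper triangular matrices with a single Jordan block\<close>

text \<open>Entry \<open>(i, j)\<close> of the power sums over paths of \<open>r\<close> strictly
  increasing steps from \<open>i\<close> to \<open>j\<close>. There is none if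
  \<open>j < i + r\<close>, and for \<open>j = i + r\<close> only the path along the
  superdiagonal.\<close>

lemma strict_upper_pow:
  fixes N :: "'a::comm_ring_1 mat"
  assumes N: "N \<in> carrier_mat n n"
    and z: "\<And>i j. i < n \<Longrightarrow> j \<le> i \<Longrightarrow> N $$ (i, j) = 0"
    and s: "\<And>i. Suc i < n \<Longrightarrow> N $$ (i, Suc i) = s"
    and ij: "i < n" "j < n"
  shows "j < i + r \<Longrightarrow> (N ^\<^sub>m r) $$ (i, j) = 0"
    and "j = i + r \<Longrightarrow> (N ^\<^sub>m r) $$ (i, j) = s ^ r"
proof -
  have "(j < i + r \<longrightarrow> (N ^\<^sub>m r) $$ (i, j) = 0) \<and> (j = i + r \<longrightarrow> (N ^\<^sub>m r) $$ (i, j) = s ^ r)"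
    using ij
  proof (induction r arbitrary: j)
    case 0
    then show ?case using N by auto
  next
    case (Suc r)
    have eq: "(N ^\<^sub>m Suc r) $$ (i, j) = (\<Sum>l<n. (N ^\<^sub>m r) $$ (i, l) * N $$ (l, j))"
      using N Suc.prems by (simp add: scalar_prod_def atLeast0LessThan)
    have zero: "(N ^\<^sub>m r) $$ (i, l) * N $$ (l, j) = 0" if "l < n" "l < i + r \<or> j \<le> l" for l
      using that Suc z by auto
    show ?case
    proof (intro conjI impI)
      assume "j < i + Suc r"
      then show "(N ^\<^sub>m Suc r) $$ (i, j) = 0" unfolding eq
        by (intro sum.neutral ballI zero) auto
    next
      assume j: "j = i + Suc r"
      have "(\<Sum>l<n. (N ^\<^sub>m r) $$ (i, l) * N $$ (l, j)) = (\<Sum>l\<in>{i + r}. (N ^\<^sub>m r) $$ (i, l) * N $$ (l, j))"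
        using Suc.prems j by (intro sum.mono_neutral_right ballI zero) auto
      also have "\<dots> = s ^ Suc r"
        using Suc.IH[of "i + r"] Suc.prems j s[of "i + r"] by (simp add: mult.commute)
      finally show "(N ^\<^sub>m Suc r) $$ (i, j) = s ^ Suc r" unfolding eq .
    qed
  qed
  then show "j < i + r \<Longrightarrow> (N ^\<^sub>m r) $$ (i, j) = 0"
    and "j = i + r \<Longrightarrow> (N ^\<^sub>m r) $$ (i, j) = s ^ r" by auto
qed

lemma pow_mat_comm:
  fixes N :: "'a::semiring_1 mat"
  assumes "N \<in> carrier_mat n n"
  shows "N * N ^\<^sub>m k = N ^\<^sub>m k * N"
proof (induction k)
  case (Suc k)
  have "N * (N ^\<^sub>m k * N) = (N * N ^\<^sub>m k) * N"
    using assms by (simp add: assoc_mult_mat[of _ n n _ n _ n])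
  then show ?case using Suc by simp
qed (use assms in simp)

lemma mat_inverse_exists:
  fixes P :: "'a::field mat"
  assumes "P \<in> carrier_mat n n" "Determinant.det P \<noteq> 0"
  obtains Q where "Q \<in> carrier_mat n n" "P * Q = 1\<^sub>m n" "Q * P = 1\<^sub>m n"
  using det_non_zero_imp_unit[OF assms, of n] unfolding Units_def ring_mat_def by auto

text \<open>A nonzero superdiagonal makes the last unit vector cyclic for the nilpotent matrix
  \<open>E - c\<close>, so that there is only one block. For the exponential of a Jordan block with
  eigenvalue \<open>a\<close>, both \<open>c\<close> and \<open>s\<close> are \<open>exp a\<close>,
  which never vanishes.\<close>

lemma similar_jordan_block_upper_triangular:
  fixes E :: "'a::field mat"
  assumes E: "E \<in> carrier_mat n n"
    and z: "\<And>i j. i < n \<Longrightarrow> j < i \<Longrightarrow> E $$ (i, j) = 0"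
    and d: "\<And>i. i < n \<Longrightarrow> E $$ (i, i) = c"
    and s: "\<And>i. Suc i < n \<Longrightarrow> E $$ (i, Suc i) = s" and "s \<noteq> 0"
  shows "similar_mat E (jordan_block n c)"
proof -
  define N where "N = E - c \<cdot>\<^sub>m 1\<^sub>m n"
  have N: "N \<in> carrier_mat n n" unfolding N_def using E by auto
  have N0: "N $$ (i, j) = 0" if "i < n" "j \<le> i" for i j
    using that E z d by (auto simp: N_def)
  have N1: "N $$ (i, Suc i) = s" if "Suc i < n" for i
    using that E s by (auto simp: N_def)
  note Npow = strict_upper_pow[OF N N0 N1]
  \<comment> \<open>The columns of \<open>P\<close> form the chain \<open>N\<^sup>n\<^sup>-\<^sup>1 e, \<dots>, N e, e\<close> of the last unit vector \<open>e\<close>.\<close>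
  define P where "P = Matrix.mat n n (\<lambda>(i, j). (N ^\<^sub>m (n - 1 - j)) $$ (i, n - 1))"
  have P: "P \<in> carrier_mat n n" unfolding P_def by simp
  \<comment> \<open>Below the diagonal, \<open>j < i\<close> gives
    \<open>n - 1 < i + (n - 1 - j)\<close>, where the power vanishes; on the diagonal equality holds
    and leaves a power of \<open>s\<close>.\<close>
  have "upper_triangular P"
    unfolding upper_triangular_def P_def by (auto intro!: Npow(1))
  moreover have diag: "P $$ (i, i) = s ^ (n - 1 - i)" if "i < n" for i
    using that Npow(2)[of i "n - 1" "n - 1 - i"] by (simp add: P_def)
  ultimately have "Determinant.det P = (\<Prod>i\<leftarrow>[0..<n]. s ^ (n - 1 - i))"
    using P by (subst det_upper_triangular[of P n]) (auto simp: diag_mat_def intro!: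
        arg_cong[of _ _ prod_list])
  then have "Determinant.det P \<noteq> 0"
    using \<open>s \<noteq> 0\<close> by (auto simp: prod_list_zero_iff)
  then obtain Q where Q: "Q \<in> carrier_mat n n" "P * Q = 1\<^sub>m n" "Q * P = 1\<^sub>m n"
    using mat_inverse_exists[OF P] by metis
  have "E * P = P * jordan_block n c"
  proof (rule eq_matI)
    fix i j assume "i < dim_row (P * jordan_block n c)" "j < dim_col (P * jordan_block n c)"
    then have ij: "i < n" "j < n" using P by auto
    have "E = N + c \<cdot>\<^sub>m 1\<^sub>m n" using E unfolding N_def by (intro eq_matI) auto
    then have "(E * P) $$ (i, j) = (N * P) $$ (i, j) + c * P $$ (i, j)"
      using N P ij by (simp add: add_mult_distrib_mat[of _ n n])
    also have "(N * P) $$ (i, j) = (N ^\<^sub>m Suc (n - 1 - j)) $$ (i, n - 1)"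
    proof -
      have "(N * P) $$ (i, j) = (N * N ^\<^sub>m (n - 1 - j)) $$ (i, n - 1)"
        using N P ij by (auto simp: scalar_prod_def P_def intro!: sum.cong)
      also have "N * N ^\<^sub>m (n - 1 - j) = N ^\<^sub>m Suc (n - 1 - j)"
        using pow_mat_comm[OF N] by simp
      finally show ?thesis .
    qed
    \<comment> \<open>\<open>N\<close> moves each column of \<open>P\<close> to its left neighbour
      and kills the first one, since its \<open>n\<close>-th power vanishes.\<close>
    also have "\<dots> = (if j = 0 then 0 else P $$ (i, j - 1))"
      using Npow(1)[of i "n - 1" n] ij by (auto simp: P_def Suc_diff_Suc simp del: pow_mat.simps)
    also have "\<dots> + c * P $$ (i, j) = (P * jordan_block n c) $$ (i, j)"
    proof -
      have "(P * jordan_block n c) $$ (i, j) = (\<Sum>l<n. P $$ (i, l) * jordan_block n c $$ (l, j))"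
        using P ij by (simp add: scalar_prod_def atLeast0LessThan)
      also have "\<dots> = (\<Sum>l<n. (if l = j then P $$ (i, l) * c else 0) + (if Suc l =
          j then P $$ (i, l) else 0))"
        using ij by (intro sum.cong refl) auto
      also have "\<dots> = P $$ (i, j) * c + (\<Sum>l<n. (if Suc l = j then P $$ (i, l) else 0))"
        using ij by (simp add: sum.distrib)
      also have "(\<Sum>l<n. (if Suc l = j then P $$ (i, l) else 0)) = (if j =
          0 then 0 else P $$ (i, j - 1))"
        using ij by (cases j) auto
      finally show ?thesis by (simp add: mult.commute)
    qed
    finally show "(E * P) $$ (i, j) = (P * jordan_block n c) $$ (i, j)" .
  qed (use E P in auto)
  then have "P * jordan_block n c * Q = E * (P * Q)"
    using assoc_mult_mat[OF E P Q(1)] by simp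
  then have "E = P * jordan_block n c * Q" using E Q by simp
  then show ?thesis using E P Q by (intro similar_matI[of _ _ P Q n]) auto
qed

abbreviation exp_block :: "nat \<times> complex \<Rightarrow> nat \<times> complex" where
  "exp_block \<equiv> map_prod id exp"

lemma has_mexp_jordan_block_similar:
  "\<exists>E. has_mexp (jordan_block n a) 1 E \<and> similar_mat E (jordan_block n (exp a))"
proof -
  let ?E = "Matrix.mat n n (\<lambda>(i, j). if i \<le> j then 1 ^ (j - i) / fact (j - i) * exp (1 * a) else 0)"
  have "similar_mat ?E (jordan_block n (exp a))"
    by (rule similar_jordan_block_upper_triangular[where s = "exp a"]) auto
  then show ?thesis using has_mexp_jordan_block by blast
qed

lemma has_mexp_jordan_matrix:
  "\<exists>E. has_mexp (jordan_matrix bs) 1 E \<and> similar_mat E (jordan_matrix (map exp_block bs))"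
proof (induction bs)
  case Nil
  have "has_mexp (jordan_matrix []) 1 (jordan_matrix [])"
    using jordan_matrix_carrier[of "[]"] by (intro has_mexpI[of _ 0]) auto
  then show ?case by (auto intro!: exI[of _ "jordan_matrix []"] similar_mat_refl[of _ 0] carrier_matI)
next
  case (Cons b bs)
  obtain n a where b: "b = (n, a)" by force
  obtain E where E: "has_mexp (jordan_block n a) 1 E" "similar_mat E (jordan_block n (exp a))"
    using has_mexp_jordan_block_similar by blast
  obtain F where F: "has_mexp (jordan_matrix bs) 1 F" "similar_mat F (jordan_matrix (map exp_block bs))"
    using Cons by blast
  let ?m = "sum_list (map fst bs)"
  have m: "sum_list (map fst (map exp_block bs)) = ?m" by (simp add: o_def)
  have "has_mexp (jordan_matrix (b # bs)) 1 (four_block_mat E (0\<^sub>m n ?m) (0\<^sub>m ?m n) F)"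
    unfolding b jordan_matrix_Cons by (intro has_mexp_four_block E F) auto
  moreover have "similar_mat (four_block_mat E (0\<^sub>m n ?m) (0\<^sub>m ?m n) F) (jordan_matrix (map
      exp_block (b # bs)))"
    using similar_mat_four_block_0_0[OF E(2) F(2) has_mexpD(1)[OF E(1) jordan_block_carrier]
       has_mexpD(1)[OF F(1) jordan_matrix_carrier]] m
    by (simp add: b jordan_matrix_Cons)
  ultimately show ?case by blast
qed

lemma jordan_nf_has_mexp:
  assumes "jordan_nf A bs"
  obtains E where "has_mexp A 1 E" "jordan_nf E (map exp_block bs)"
proof -
  obtain E where E: "has_mexp (jordan_matrix bs) 1 E" "similar_mat E (jordan_matrix (map exp_block bs))"
    using has_mexp_jordan_matrix by blast
  obtain P Q where wit: "similar_mat_wit A (jordan_matrix bs) P Q"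
    using assms unfolding jordan_nf_def similar_mat_def by auto
  define n where "n = dim_row A"
  note w = similar_mat_witD[OF n_def wit]
  have "E \<in> carrier_mat n n" using has_mexpD(1)[OF E(1) w(5)] .
  then have "similar_mat (P * E * Q) E"
    using w by (intro similar_matI[of _ _ P Q n]) auto
  then have "jordan_nf (P * E * Q) (map exp_block bs)"
    using assms similar_mat_trans[OF _ E(2)] unfolding jordan_nf_def by (auto simp: image_image)
  then show ?thesis using has_mexp_similar[OF E(1) wit] that by blast
qed

section \<open>Exponential polynomials\<close>

text \<open>The exponents are fixed in a set \<open>F\<close> rather than read off from
  \<open>f\<close>, so that linear combinations stay in one class; exponents that do not occur get
  the polynomial 0.\<close>

definition exppoly :: "complex set \<Rightarrow> (complex \<Rightarrow> complex) \<Rightarrow> bool" where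
  "exppoly F f \<longleftrightarrow> (\<exists>r :: complex \<Rightarrow> complex poly. \<forall>t. f t = (\<Sum>\<mu>\<in>F. poly (r \<mu>) t * exp (t * \<mu>)))"

lemma exppoly_zero: "exppoly F (\<lambda>t. 0)"
  unfolding exppoly_def by (rule exI[of _ "\<lambda>_. 0"]) simp

lemma exppoly_add:
  assumes "exppoly F f" "exppoly F g"
  shows "exppoly F (\<lambda>t. f t + g t)"
proof -
  obtain r s where "\<And>t. f t = (\<Sum>\<mu>\<in>F. poly (r \<mu>) t * exp (t * \<mu>))"
    "\<And>t. g t = (\<Sum>\<mu>\<in>F. poly (s \<mu>) t * exp (t * \<mu>))"
    using assms unfolding exppoly_def by blast
  then show ?thesis unfolding exppoly_def
    by (intro exI[of _ "\<lambda>\<mu>. r \<mu> + s \<mu>"]) (simp add: sum.distrib distrib_right)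
qed

lemma exppoly_cmult:
  assumes "exppoly F f"
  shows "exppoly F (\<lambda>t. c * f t)"
proof -
  obtain r where "\<And>t. f t = (\<Sum>\<mu>\<in>F. poly (r \<mu>) t * exp (t * \<mu>))"
    using assms unfolding exppoly_def by blast
  then show ?thesis unfolding exppoly_def
    by (intro exI[of _ "\<lambda>\<mu>. Polynomial.smult c (r \<mu>)"]) (simp add: sum_distrib_left mult.assoc)
qed

lemma exppoly_sum:
  assumes "\<And>i. i \<in> I \<Longrightarrow> exppoly F (f i)"
  shows "exppoly F (\<lambda>t. \<Sum>i\<in>I. f i t)"
  using assms by (induction I rule: infinite_finite_induct) (auto intro: exppoly_zero exppoly_add)

lemma exppoly_monom_exp:
  assumes "finite F" "\<mu> \<in> F"
  shows "exppoly F (\<lambda>t. t ^ d * exp (t * \<mu>))"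
proof -
  let ?r = "\<lambda>\<nu>. if \<nu> = \<mu> then Polynomial.monom 1 d else (0 :: complex poly)"
  have "t ^ d * exp (t * \<mu>) = (\<Sum>\<nu>\<in>F. poly (?r \<nu>) t * exp (t * \<nu>))" for t
  proof -
    have "(\<Sum>\<nu>\<in>F. poly (?r \<nu>) t * exp (t * \<nu>)) = (\<Sum>\<nu>\<in>{\<mu>}. poly (?r \<nu>) t * exp (t * \<nu>))"
      using assms by (intro sum.mono_neutral_right) auto
    then show ?thesis by (simp add: poly_monom)
  qed
  then show ?thesis unfolding exppoly_def by (intro exI[of _ ?r] allI)
qed

text \<open>Linear independence of the sequences \<open>m ^ j * z ^ m\<close> for distinct nonzero
  \<open>z\<close>; the base 0 would be seen at \<open>m = 0\<close> only.\<close>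

lemma power_weighted_poly_sum_zero:
  fixes r :: "complex \<Rightarrow> complex poly"
  assumes "finite Z" "0 \<notin> Z"
    and "\<And>m::nat. (\<Sum>z\<in>Z. poly (r z) (of_nat m) * z ^ m) = 0"
    and "z \<in> Z"
  shows "r z = 0"
  using assms(3,4)
\<comment> \<open>The measure counts coefficients. A constant has measure 1 and the zero polynomial
  0, so that turning a constant into 0 is progress.\<close>
proof (induction "\<Sum>z\<in>Z. (if r z = 0 then 0 else Suc (degree (r z)))" arbitrary: r z rule: less_induct)
  case less
  let ?m = "\<lambda>p :: complex poly. if p = 0 then 0 else Suc (degree p)"
  show ?case
  proof (rule ccontr)
    assume nz: "r z \<noteq> 0"
    \<comment> \<open>The difference operator \<open>f \<mapsto> f (m + 1) - z f m\<close> lowers the degree of \<open>r z\<close> and keeps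
      the other degrees.\<close>
    define r' where "r' = (\<lambda>w. Polynomial.smult w (r w \<circ>\<^sub>p [:1, 1:]) - Polynomial.smult z (r w))"
    have lc: "coeff (p \<circ>\<^sub>p [:1, 1:]) (degree p) = lead_coeff p" for p :: "complex poly"
      using lead_coeff_comp[of "[:1, 1::complex:]" p] by simp
    have coeff_r': "coeff (r' w) (degree (r w)) = (w - z) * lead_coeff (r w)" for w
      unfolding r'_def by (simp add: lc algebra_simps)
    have deg: "degree (r' w) \<le> degree (r w)" for w
    proof -
      have "degree (Polynomial.smult w (r w \<circ>\<^sub>p [:1, 1:])) \<le> degree (r w)"
        using degree_smult_le[of w "r w \<circ>\<^sub>p [:1, 1:]"] by (simp add: degree_pcompose)
      then show ?thesis unfolding r'_def by (rule degree_diff_le) (rule degree_smult_le)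
    qed
    have le: "?m (r' w) \<le> ?m (r w)" for w
    proof (cases "r w = 0")
      case True
      then have "r' w = 0" unfolding r'_def by simp
      then show ?thesis by simp
    next
      case False
      then show ?thesis using deg[of w] by simp
    qed
    have "?m (r' z) < ?m (r z)"
    proof (cases "degree (r' z) = degree (r z)")
      case True
      then have "lead_coeff (r' z) = 0" using coeff_r'[of z] by simp
      then show ?thesis using nz by simp
    qed (use deg[of z] nz in auto)
    then have "(\<Sum>z\<in>Z. ?m (r' z)) < (\<Sum>z\<in>Z. ?m (r z))"
      using le less.prems(2) \<open>finite Z\<close> by (intro sum_strict_mono_ex1 bexI[of _ z] ballI) blast+
    moreover have "(\<Sum>w\<in>Z. poly (r' w) (of_nat m) * w ^ m) = 0" for m
    proof -
      have "(\<Sum>w\<in>Z. poly (r' w) (of_nat m) * w ^ m) =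
          (\<Sum>w\<in>Z. poly (r w) (of_nat (Suc m)) * w ^ Suc m) - z * (\<Sum>w\<in>Z. poly (r w) (of_nat m) * w ^ m)"
        unfolding sum_distrib_left sum_subtractf[symmetric]
        by (intro sum.cong refl) (simp add: r'_def poly_pcompose algebra_simps)
      then show ?thesis using less.prems(1)[of "Suc m"] less.prems(1)[of m] by simp
    qed
    ultimately have zero: "r' w = 0" if "w \<in> Z" for w
      using less.hyps[of r' w] that by blast
    \<comment> \<open>The top coefficient of \<open>r' w\<close> is \<open>w - z\<close> times that
      of \<open>r w\<close>, so \<open>r' w = 0\<close> leaves nothing of \<open>r w\<close> unless
      \<open>w = z\<close>. The surviving term is a polynomial with every natural number as a
      root.\<close>
    have "r w = 0" if "w \<in> Z" "w \<noteq> z" for w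
      using zero[OF that(1)] coeff_r'[of w] that by simp
    then have eq: "(\<Sum>w\<in>Z. poly (r w) (of_nat m) * w ^ m) = (\<Sum>w\<in>{z}. poly (r w) (of_nat m) * w ^ m)"
        for m
      using \<open>finite Z\<close> less.prems(2) by (intro sum.mono_neutral_right) auto
    have "poly (r z) (of_nat m) = 0" for m
    proof -
      have "z \<noteq> 0" using less.prems(2) assms(2) by metis
      moreover have "poly (r z) (of_nat m) * z ^ m = 0" using eq[of m] less.prems(1)[of m] by simp
      ultimately show ?thesis by simp
    qed
    then have "range (of_nat :: nat \<Rightarrow> complex) \<subseteq> {x. poly (r z) x = 0}" by auto
    moreover have "infinite (range (of_nat :: nat \<Rightarrow> complex))"
      by (simp add: finite_image_iff inj_of_nat)
    ultimately show False using poly_roots_finite[OF nz] finite_subset by blast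
  qed
qed

text \<open>At natural numbers \<open>exp (m * \<mu>)\<close> is the \<open>m\<close>-th power of
  \<open>exp \<mu>\<close>, and injectivity keeps these bases distinct. It is essential:
  \<open>exp (2 * pi * \<i> * t) - 1\<close> vanishes at all natural numbers. As the polynomials
  themselves vanish, the conclusion holds for every complex \<open>t\<close>.\<close>

lemma exppoly_eq_zero:
  assumes "exppoly F f" "finite F" "inj_on exp F" and "\<And>m::nat. f (of_nat m) = 0"
  shows "f t = 0"
proof -
  obtain r where r: "\<And>t. f t = (\<Sum>\<mu>\<in>F. poly (r \<mu>) t * exp (t * \<mu>))"
    using assms(1) unfolding exppoly_def by blast
  let ?g = "the_inv_into F exp"
  have "0 \<notin> exp ` F" by auto
  have g: "?g (exp \<mu>) = \<mu>" if "\<mu> \<in> F" for \<mu>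
    using that assms(3) by (simp add: the_inv_into_f_f)
  have "(\<Sum>z\<in>exp ` F. poly (r (?g z)) (of_nat m) * z ^ m) = 0" for m
    using assms(4)[of m] unfolding r sum.reindex[OF assms(3)]
    by (simp add: g exp_of_nat_mult)
  then have "r (?g z) = 0" if "z \<in> exp ` F" for z
    using power_weighted_poly_sum_zero[of "exp ` F" "\<lambda>z. r (?g z)"
        z] that assms(2) \<open>0 \<notin> exp ` F\<close> by blast
  then have "r \<mu> = 0" if "\<mu> \<in> F" for \<mu>
    using that g by (metis imageI)
  then show ?thesis unfolding r by simp
qed

lemma has_mexp_jordan_matrix_exppoly:
  assumes "finite F" "snd ` set bs \<subseteq> F"
  shows "\<exists>E. (\<forall>t. has_mexp (jordan_matrix bs) t (E t)) \<and>
    (\<forall>i < sum_list (map fst bs). \<forall>j < sum_list (map fst bs). exppoly F (\<lambda>t. E t $$ (i, j)))"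
  using assms(2)
proof (induction bs)
  case Nil
  have "has_mexp (jordan_matrix []) t (jordan_matrix [])" for t
    using jordan_matrix_carrier[of "[]"] by (intro has_mexpI[of _ 0]) auto
  then show ?case by (intro exI[of _ "\<lambda>_. jordan_matrix []"]) auto
next
  case (Cons b bs)
  obtain n a where b: "b = (n, a)" by force
  let ?E = "\<lambda>t. Matrix.mat n n (\<lambda>(i, j). if i \<le> j then t ^ (j - i) / fact (j - i) * exp (t * a) else 0)"
  let ?m = "sum_list (map fst bs)"
  obtain G where G: "\<And>t. has_mexp (jordan_matrix bs) t (G t)"
    "\<And>i j. i < ?m \<Longrightarrow> j < ?m \<Longrightarrow> exppoly F (\<lambda>t. G t $$ (i, j))"
  proof -
    have "snd ` set bs \<subseteq> F" using Cons.prems by auto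
    from Cons.IH[OF this] show thesis using that by blast
  qed
  let ?H = "\<lambda>t. four_block_mat (?E t) (0\<^sub>m n ?m) (0\<^sub>m ?m n) (G t)"
  have "has_mexp (jordan_matrix (b # bs)) t (?H t)" for t
    unfolding b jordan_matrix_Cons by (intro has_mexp_four_block G has_mexp_jordan_block) auto
  moreover have "exppoly F (\<lambda>t. ?H t $$ (i, j))"
    if ij: "i < sum_list (map fst (b # bs))" "j < sum_list (map fst (b # bs))" for i j
  proof -
    have Gdim: "dim_row (G t) = ?m" "dim_col (G t) = ?m" for t
      using has_mexpD(1)[OF G(1) jordan_matrix_carrier, of t] by auto
    have "exppoly F (\<lambda>t. 1 / fact (j - i) * (t ^ (j - i) * exp (t * a)))"
      using assms(1) Cons.prems b by (intro exppoly_cmult exppoly_monom_exp) auto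
    then show ?thesis
      using ij G(2)[of "i - n" "j - n"]
      by (cases "i < n"; cases "j < n"; cases "i \<le> j") (auto simp: b Gdim exppoly_zero)
  qed
  ultimately show ?case by (intro exI[of _ ?H] conjI allI impI)
qed

lemma has_mexp_exppoly:
  assumes A: "A \<in> carrier_mat n n" and F: "finite F" "\<And>z. eigenvalue A z \<Longrightarrow> z \<in> F"
  obtains E where "\<And>t. has_mexp A t (E t)" "\<And>i j. i < n \<Longrightarrow> j < n \<Longrightarrow> exppoly F (\<lambda>t. E t $$ (i, j))"
proof -
  obtain bs where bs: "jordan_nf A bs" using jordan_nf_complex_exists[OF A] by blast
  obtain P Q where wit: "similar_mat_wit A (jordan_matrix bs) P Q"
    using bs unfolding jordan_nf_def similar_mat_def by auto
  note w = similar_mat_witD2[OF A wit]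
  have n: "sum_list (map fst bs) = n" using w(5) by (metis carrier_matD(1) jordan_matrix_dim(1))
  have "snd ` set bs \<subseteq> F"
  proof safe
    fix k a assume kb: "(k, a) \<in> set bs"
    then have "k \<le> Polynomial.order a (char_poly A)" "k \<noteq> 0"
      using jordan_nf_block_size_order_bound[OF bs] bs unfolding jordan_nf_def by force+
    then have "poly (char_poly A) a = 0" by (auto simp: order_root)
    then show "snd (k, a) \<in> F" using F(2) eigenvalue_root_char_poly[OF A] by auto
  qed
  from has_mexp_jordan_matrix_exppoly[OF F(1) this] obtain G where
    G: "\<And>t. has_mexp (jordan_matrix bs) t (G t)"
    "\<And>i j. i < n \<Longrightarrow> j < n \<Longrightarrow> exppoly F (\<lambda>t. G t $$ (i, j))"
    unfolding n by auto
  show thesis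
  proof (rule that)
    show "has_mexp A t (P * G t * Q)" for t using has_mexp_similar[OF G(1) wit] .
    fix i j assume ij: "i < n" "j < n"
    have "(P * G t * Q) $$ (i, j) = (\<Sum>l<n. \<Sum>m<n. (P $$ (i, m) * Q $$ (l, j)) * G t $$ (m, l))" for t
      using mult_mat3_index[OF w(6) has_mexpD(1)[OF G(1) w(5), of t] w(7) ij] by (simp add: mult_ac)
    then show "exppoly F (\<lambda>t. (P * G t * Q) $$ (i, j))"
      using ij G(2) by (simp del: sum.lessThan_Suc) (intro exppoly_sum exppoly_cmult, auto)
  qed
qed

section \<open>Real matrices among the complex ones\<close>

abbreviation mat_cnj :: "complex mat \<Rightarrow> complex mat" where
  "mat_cnj \<equiv> map_mat cnj"

interpretation cnj_hom: comm_ring_hom cnj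
  by unfold_locales auto

lemma mat_cnj_mult:
  "A \<in> carrier_mat n m \<Longrightarrow> B \<in> carrier_mat m k \<Longrightarrow> mat_cnj (A * B) = mat_cnj A * mat_cnj B"
  by (rule cnj_hom.mat_hom_mult)

lemma mat_cnj_jordan_matrix: "mat_cnj (jordan_matrix bs) = jordan_matrix (map (map_prod id cnj) bs)"
proof (induction bs)
  case Nil
  show ?case by (intro eq_matI) auto
next
  case (Cons b bs)
  obtain n a where b: "b = (n, a)" by force
  have "mat_cnj (jordan_block n a) = jordan_block n (cnj a)"
    by (intro eq_matI) auto
  moreover have zero: "mat_cnj (0\<^sub>m r c) = 0\<^sub>m r c" for r c by (intro eq_matI) auto
  ultimately show ?case
    unfolding b jordan_matrix_Cons
    by (subst map_four_block_mat[OF jordan_block_carrier zero_carrier_mat zero_carrier_mat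
        jordan_matrix_carrier])
      (simp add: Cons jordan_matrix_Cons o_def id_def zero)
qed

lemma jordan_nf_cnj:
  assumes "jordan_nf A bs"
  shows "jordan_nf (mat_cnj A) (map (map_prod id cnj) bs)"
proof -
  obtain P Q where wit: "similar_mat_wit A (jordan_matrix bs) P Q"
    using assms unfolding jordan_nf_def similar_mat_def by auto
  define n where "n = dim_row A"
  note w = similar_mat_witD[OF n_def wit]
  have "similar_mat_wit (mat_cnj A) (mat_cnj (jordan_matrix bs)) (mat_cnj P) (mat_cnj Q)"
  proof (rule similar_mat_witI[of _ _ n])
    show "mat_cnj P * mat_cnj Q = 1\<^sub>m n" "mat_cnj Q * mat_cnj P = 1\<^sub>m n"
      using w(1) mat_cnj_mult[OF w(6,7)] w(2) mat_cnj_mult[OF w(7,6)] by (metis cnj_hom.mat_hom_one)+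
    show "mat_cnj A = mat_cnj P * mat_cnj (jordan_matrix bs) * mat_cnj Q"
      using w mat_cnj_mult[of "P * jordan_matrix bs" n n Q n] mat_cnj_mult[of P n n "jordan_matrix
          bs" n]
      by (metis mult_carrier_mat)
  qed (use w in auto)
  then show ?thesis
    using assms unfolding jordan_nf_def similar_mat_def mat_cnj_jordan_matrix by force
qed

text \<open>Combined with uniqueness, this shows that the exponential of a real matrix at a real
  \<open>t\<close> is real.\<close>

lemma has_mexp_cnj:
  assumes "has_mexp A t E" 
  shows "has_mexp (mat_cnj A) (cnj t) (mat_cnj E)"
proof -
  obtain n where A: "A \<in> carrier_mat n n" using has_mexp_carrier[OF assms] by metis
  note E = has_mexpD[OF assms A]
  show ?thesis
  proof (rule has_mexpI[of _ n])
    fix i j assume ij: "i < n" "j < n"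
    have "(\<lambda>k. cnj ((A ^\<^sub>m k) $$ (i, j) * t ^ k / fact k)) sums cnj (E $$ (i, j))"
      using E(2)[OF ij] by (simp only: sums_cnj)
    then show "(\<lambda>k. (mat_cnj A ^\<^sub>m k) $$ (i, j) * cnj t ^ k / fact k) sums (mat_cnj E $$ (i, j))"
      using ij A E(1) by (simp flip: cnj_hom.mat_hom_pow[OF A])
  qed (use A E in auto)
qed

lemma inverse_mat_cnj:
  assumes "P \<in> carrier_mat n n" "Q \<in> carrier_mat n n" "P * Q = 1\<^sub>m n" "Q * P = 1\<^sub>m n" "mat_cnj P = P"
  shows "mat_cnj Q = Q"
proof -
  have "mat_cnj Q = mat_cnj Q * (P * Q)" using assms by simp
  also have "\<dots> = (mat_cnj Q * P) * Q"
    using assms by (subst assoc_mult_mat[of _ n n]) auto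
  also have "mat_cnj Q * P = 1\<^sub>m n"
    using mat_cnj_mult[of Q n n P n] assms by (simp add: cnj_hom.mat_hom_one)
  finally show ?thesis using assms by simp
qed

section \<open>Similarity of real matrices by a real matrix\<close>

lemma det_add_smult_poly:
  fixes R S :: "complex mat"
  assumes "R \<in> carrier_mat n n" "S \<in> carrier_mat n n"
  obtains p where "\<And>t. Determinant.det (R + t \<cdot>\<^sub>m S) = poly p t"
proof -
  let ?M = "Matrix.mat n n (\<lambda>ij. [:R $$ ij, S $$ ij:])"
  have "Determinant.det (R + t \<cdot>\<^sub>m S) = poly (Determinant.det ?M) t" for t
    by (rule poly_det_cong[of _ n, symmetric]) (use assms in auto)
  then show thesis using that by blast
qed

text \<open>The determinant is a polynomial in the parameter. A complex \<open>c\<close> is enough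
  to see that it is not zero, although the roots counted are real.\<close>

lemma finite_singular_pencil:
  fixes R S :: "complex mat"
  assumes "R \<in> carrier_mat n n" "S \<in> carrier_mat n n" "Determinant.det (R + c \<cdot>\<^sub>m S) \<noteq> 0"
  shows "finite {t::real. Determinant.det (R + complex_of_real t \<cdot>\<^sub>m S) = 0}"
proof -
  obtain p where p: "\<And>t. Determinant.det (R + t \<cdot>\<^sub>m S) = poly p t"
    using det_add_smult_poly[OF assms(1,2)] by blast
  have "p \<noteq> 0" using assms(3) p[of c] by auto
  then have "finite {z. poly p z = 0}" by (rule poly_roots_finite)
  then have "finite (complex_of_real -` {z. poly p z = 0})"
    by (rule finite_vimageI) (simp add: inj_of_real)
  then show ?thesis by (simp add: p vimage_def)
qed

text \<open>If \<open>A P = P B\<close> with \<open>P = R + \<i> S\<close>, then the pencil \<open>R + t S\<close> intertwines \<open>A\<close> and \<open>B\<close> as well,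
  and it is invertible for all but finitely many real \<open>t\<close>.\<close>

lemma similar_mat_real:
  assumes sim: "similar_mat A B" and A: "mat_cnj A = A" and B: "mat_cnj B = B"
  obtains P Q where "similar_mat_wit A B P Q" "mat_cnj P = P" "mat_cnj Q = Q"
proof -
  obtain U V where wit: "similar_mat_wit A B U V" using sim unfolding similar_mat_def by auto
  define n where "n = dim_row A"
  note w = similar_mat_witD[OF n_def wit]
  have cU: "mat_cnj U \<in> carrier_mat n n" using w by auto
  have AU: "A * U = U * B"
  proof -
    have "A * U = U * B * (V * U)" using w by (simp add: assoc_mult_mat[of _ n n _ n _ n])
    then show ?thesis using w by simp
  qed
  then have AcU: "A * mat_cnj U = mat_cnj U * B"
    using mat_cnj_mult[of A n n U n] mat_cnj_mult[of U n n B n] w A B by simp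
  define R where "R = U + mat_cnj U"
  define S where "S = \<i> \<cdot>\<^sub>m U + (-\<i>) \<cdot>\<^sub>m mat_cnj U"
  have RS: "R \<in> carrier_mat n n" "S \<in> carrier_mat n n" unfolding R_def S_def using cU by auto
  have AR: "A * R = R * B" unfolding R_def
    using w cU AU AcU by (simp add: mult_add_distrib_mat[of _ n n] add_mult_distrib_mat[of _ n n])
  have AS: "A * S = S * B"
  proof -
    have "A * S = \<i> \<cdot>\<^sub>m (A * U) + (-\<i>) \<cdot>\<^sub>m (A * mat_cnj U)" unfolding S_def
      using mult_add_distrib_mat[of A n n "\<i> \<cdot>\<^sub>m U" n "(-\<i>) \<cdot>\<^sub>m mat_cnj U"]
        mult_smult_distrib[OF w(4,6)] mult_smult_distrib[OF w(4) cU] w(4,6) cU by simp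
    also have "\<dots> = S * B" unfolding S_def AU AcU
      using add_mult_distrib_mat[of "\<i> \<cdot>\<^sub>m U" n n "(-\<i>) \<cdot>\<^sub>m mat_cnj U" B n]
        mult_smult_assoc_mat[OF w(6,5)] mult_smult_assoc_mat[OF cU w(5)] w(5,6) cU by simp
    finally show ?thesis .
  qed
  \<comment> \<open>The nonreal parameter \<open>-\<i>\<close> recovers twice the invertible
    \<open>U\<close>, so the determinant of the pencil is not identically zero.\<close>
  have "R + (-\<i>) \<cdot>\<^sub>m S = 2 \<cdot>\<^sub>m U"
    unfolding R_def S_def using w cU by (intro eq_matI) (auto simp: algebra_simps)
  moreover have "Determinant.det U \<noteq> 0"
    using Determinant.det_mult[OF w(6,7)] w(1) by auto
  ultimately have "Determinant.det (R + (-\<i>) \<cdot>\<^sub>m S) \<noteq> 0" by simp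
  from finite_singular_pencil[OF RS this]
  obtain t :: real where t: "Determinant.det (R + complex_of_real t \<cdot>\<^sub>m S) \<noteq> 0"
    using ex_new_if_finite[OF infinite_UNIV_char_0] by blast
  define P where "P = R + complex_of_real t \<cdot>\<^sub>m S"
  have P: "P \<in> carrier_mat n n" unfolding P_def using RS by auto
  obtain Q where Q: "Q \<in> carrier_mat n n" "P * Q = 1\<^sub>m n" "Q * P = 1\<^sub>m n"
    using mat_inverse_exists[OF P] t unfolding P_def by metis
  have Pr: "mat_cnj P = P"
    unfolding P_def R_def S_def using w by (intro eq_matI) (auto simp: algebra_simps)
  have "A * P = P * B" unfolding P_def
    using w RS AR AS by (simp add: mult_add_distrib_mat[of _ n n] add_mult_distrib_mat[of _ n n]
        mult_smult_distrib[of _ n n] mult_smult_assoc_mat[of _ n n])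
  then have "A = P * B * Q"
    using assoc_mult_mat[OF w(4) P Q(1)] Q w(4) by simp
  then have "similar_mat_wit A B P Q" using w P Q by (intro similar_mat_witI) auto
  then show thesis using that Pr inverse_mat_cnj[OF P Q Pr] by blast
qed

section \<open>Real matrices with prescribed Jordan blocks\<close>

lemma similar_four_block_swap:
  fixes A :: "'a::comm_ring_1 mat"
  assumes A: "A \<in> carrier_mat n n" and B: "B \<in> carrier_mat m m"
  shows "similar_mat (four_block_mat A (0\<^sub>m n m) (0\<^sub>m m n) B) (four_block_mat B (0\<^sub>m m n) (0\<^sub>m n m) A)"
proof -
  let ?W = "\<lambda>n m. four_block_mat (0\<^sub>m n m) (1\<^sub>m n) (1\<^sub>m m) (0\<^sub>m m n) :: 'a mat"
  have WW: "?W n m * ?W m n = 1\<^sub>m (n + m)" for n m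
    by (subst mult_four_block_mat[of _ n m _ n _ m _ _ n _ m]) auto
  have "?W n m * four_block_mat B (0\<^sub>m m n) (0\<^sub>m n m) A = four_block_mat (0\<^sub>m n m) A B (0\<^sub>m m n)"
    using A B by (subst mult_four_block_mat[of _ n m _ n _ m _ _ m _ n]) auto
  moreover have "four_block_mat (0\<^sub>m n m) A B (0\<^sub>m m n) * ?W m n =
      four_block_mat A (0\<^sub>m n m) (0\<^sub>m m n) B"
    using A B by (subst mult_four_block_mat[of _ n m _ n _ m _ _ n _ m]) auto
  ultimately show ?thesis
    using A B WW[of n m] WW[of m n]
    by (intro similar_matI[of _ _ "?W n m" "?W m n" "n + m"]) (auto simp: add.commute)
qed

lemma jordan_matrix_append: "jordan_matrix (xs @ ys) = four_block_mat
  (jordan_matrix xs) (0\<^sub>m (sum_list (map fst xs)) (sum_list (map fst ys)))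
  (0\<^sub>m (sum_list (map fst ys)) (sum_list (map fst xs))) (jordan_matrix ys)"
  using diag_block_mat_append[of "map (\<lambda>(n, a). jordan_block n a) xs"
      "map (\<lambda>(n, a). jordan_block n a) ys"]
  by (simp only: Let_def jordan_matrix_def[symmetric] map_append[symmetric] jordan_matrix_dim)

lemma jordan_matrix_swap:
  fixes xs ys :: "(nat \<times> 'a::comm_ring_1) list"
  shows "similar_mat (jordan_matrix (xs @ ys)) (jordan_matrix (ys @ xs))"
  unfolding jordan_matrix_append by (rule similar_four_block_swap) auto

text \<open>A Jordan form is a list, while blocks are compared as multisets. Rotations of a list are
  similarities, and together with permutations of the tail they generate all orders.\<close>

lemma jordan_matrix_mset:
  fixes bs :: "(nat \<times> 'a::comm_ring_1) list"
  shows "mset bs = mset cs \<Longrightarrow> similar_mat (jordan_matrix bs) (jordan_matrix cs)"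
proof (induction bs arbitrary: cs)
  case Nil
  then show ?case by (auto intro: similar_mat_refl[OF jordan_matrix_carrier])
next
  case (Cons b bs)
  have "b \<in> set cs" using mset_eq_setD[OF Cons.prems] by auto
  then obtain xs ys where cs: "cs = xs @ b # ys" by (meson split_list)
  obtain n a where b: "b = (n, a)" by force
  have m: "mset bs = mset (ys @ xs)" using Cons.prems cs by simp
  then have dim: "sum_list (map fst bs) = sum_list (map fst (ys @ xs))"
    by (metis mset_map sum_mset_sum_list)
  have "similar_mat (jordan_matrix (b # bs)) (jordan_matrix (b # ys @ xs))"
    using similar_mat_four_block_0_0[OF similar_mat_refl[OF jordan_block_carrier] Cons.IH[OF m] 
        jordan_block_carrier jordan_matrix_carrier] dim
    by (simp add: b jordan_matrix_Cons)
  moreover have "similar_mat (jordan_matrix ((b # ys) @ xs)) (jordan_matrix cs)"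
    unfolding cs by (rule jordan_matrix_swap)
  ultimately show ?case using similar_mat_trans by fastforce
qed

lemma jordan_nf_mset:
  fixes bs :: "(nat \<times> 'a::comm_ring_1) list"
  assumes "jordan_nf A bs" "mset bs = mset cs"
  shows "jordan_nf A cs"
  using assms similar_mat_trans[OF _ jordan_matrix_mset[OF assms(2)]] mset_eq_setD[OF assms(2)]
  unfolding jordan_nf_def by auto

text \<open>\<open>Z\<close> is the realification of \<open>C\<close>: with
  \<open>C = A + \<i> B\<close> for real \<open>A\<close> and \<open>B\<close>, it has the block
  rows \<open>A, -B\<close> and \<open>B, A\<close>. The two block columns of \<open>?U\<close> span
  the eigenspaces of the complex structure, on which \<open>Z\<close> acts as \<open>C\<close> and
  as its conjugate.\<close>

lemma real_mat_jordan_nf_pair: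
  assumes "0 \<notin> fst ` set ps"
  shows "\<exists>Z. mat_cnj Z = Z \<and> jordan_nf Z (ps @ map (map_prod id cnj) ps)"
proof -
  define n where "n = sum_list (map fst ps)"
  define C where "C = jordan_matrix ps"
  define D where "D = mat_cnj C"
  have n': "sum_list (map fst (map (map_prod id cnj) ps)) = n" by (simp add: n_def o_def)
  have C: "C \<in> carrier_mat n n" and D: "D \<in> carrier_mat n n" by (simp_all add: C_def D_def n_def)
  let ?O = "0\<^sub>m n n :: complex mat" and ?I = "1\<^sub>m n :: complex mat"
  let ?U = "four_block_mat ?I ?I ((-\<i>) \<cdot>\<^sub>m ?I) (\<i> \<cdot>\<^sub>m ?I)"
  let ?V = "four_block_mat ((1/2) \<cdot>\<^sub>m ?I) ((\<i>/2) \<cdot>\<^sub>m ?I) ((1/2) \<cdot>\<^sub>m ?I) ((-\<i>/2) \<cdot>\<^sub>m ?I)"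
  let ?J = "four_block_mat C ?O ?O D"
  define Z where "Z = four_block_mat ((1/2) \<cdot>\<^sub>m (C + D)) ((\<i>/2) \<cdot>\<^sub>m (C - D))
    ((-\<i>/2) \<cdot>\<^sub>m (C - D)) ((1/2) \<cdot>\<^sub>m (C + D))"
  have sm: "(a \<cdot>\<^sub>m ?I) * M = a \<cdot>\<^sub>m M" "M * (a \<cdot>\<^sub>m ?I) = a \<cdot>\<^sub>m M" if "M \<in> carrier_mat n n" for a M
    using that mult_smult_assoc_mat[of ?I n n M n a] mult_smult_distrib[of M n n ?I n a] by auto
  have UV: "?U * ?V = 1\<^sub>m (n + n)"
    by (subst mult_four_block_mat[of _ n n _ n _ n _ _ n _ n], auto simp: sm
        simp flip: four_block_one_mat intro!: cong_four_block_mat eq_matI)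
  have VU: "?V * ?U = 1\<^sub>m (n + n)"
    by (subst mult_four_block_mat[of _ n n _ n _ n _ _ n _ n], auto simp: sm
        simp flip: four_block_one_mat intro!: cong_four_block_mat eq_matI)
  have "?U * ?J = four_block_mat C D ((-\<i>) \<cdot>\<^sub>m C) (\<i> \<cdot>\<^sub>m D)"
    using C D by (subst mult_four_block_mat[of _ n n _ n _ n _ _ n _ n]) (auto simp: sm)
  moreover have "four_block_mat C D ((-\<i>) \<cdot>\<^sub>m C) (\<i> \<cdot>\<^sub>m D) * ?V = Z"
    using C D unfolding Z_def
    by (subst mult_four_block_mat[of _ n n _ n _ n _ _ n _ n])
      (auto simp: sm algebra_simps intro!: cong_four_block_mat eq_matI)
  ultimately have "Z = ?U * ?J * ?V" by simp
  moreover have "Z \<in> carrier_mat (n + n) (n + n)" using C D unfolding Z_def by auto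
  ultimately have "similar_mat Z ?J"
    using C D UV VU by (intro similar_matI[of _ _ ?U ?V "n + n"]) auto
  moreover have "?J = jordan_matrix (ps @ map (map_prod id cnj) ps)"
    unfolding jordan_matrix_append n' by (simp add: C_def D_def n_def mat_cnj_jordan_matrix)
  moreover have "mat_cnj Z = Z"
  proof -
    have "mat_cnj ((1/2) \<cdot>\<^sub>m (C + D)) = (1/2) \<cdot>\<^sub>m (C + D)"
      "mat_cnj ((\<i>/2) \<cdot>\<^sub>m (C - D)) = (\<i>/2) \<cdot>\<^sub>m (C - D)"
      "mat_cnj ((-\<i>/2) \<cdot>\<^sub>m (C - D)) = (-\<i>/2) \<cdot>\<^sub>m (C - D)"
      using C by (auto simp: D_def algebra_simps intro!: eq_matI)
    then show ?thesis unfolding Z_def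
      using C D by (subst map_four_block_mat[of _ n n _ n _ n]) auto
  qed
  ultimately show ?thesis using assms unfolding jordan_nf_def
    by (intro exI[of _ Z]) (force simp: image_image)
qed

lemma real_mat_jordan_nf:
  assumes ps: "0 \<notin> fst ` set ps" and rs: "0 \<notin> fst ` set rs" "\<And>b. b \<in> set rs \<Longrightarrow> snd b \<in> \<real>"
  shows "\<exists>Z. mat_cnj Z = Z \<and> jordan_nf Z (ps @ map (map_prod id cnj) ps @ rs)"
proof -
  obtain Z where Z: "mat_cnj Z = Z" "jordan_nf Z (ps @ map (map_prod id cnj) ps)"
    using real_mat_jordan_nf_pair[OF ps] by blast
  define n where "n = dim_row Z"
  have Zc: "Z \<in> carrier_mat n n"
    using Z(2) unfolding jordan_nf_def n_def by (meson similar_mat_def similar_mat_witD(4))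
  let ?m = "sum_list (map fst rs)"
  have "map (map_prod id cnj) rs = rs"
    using rs(2) by (intro map_idI) (auto simp: map_prod_def Reals_cnj_iff split: prod.splits)
  then have J: "mat_cnj (jordan_matrix rs) = jordan_matrix rs" by (simp add: mat_cnj_jordan_matrix)
  have nf: "jordan_nf (jordan_matrix rs) rs"
    using rs(1) unfolding jordan_nf_def by (auto intro: similar_mat_refl[OF jordan_matrix_carrier])
  have "jordan_nf (diag_block_mat (map fst [(Z, ps @ map (map_prod id cnj) ps), (jordan_matrix rs,
      rs)]))
      (concat (map snd [(Z, ps @ map (map_prod id cnj) ps), (jordan_matrix rs, rs)]))"
    by (rule jordan_nf_diag_block_mat) (use Z nf in auto)
  moreover have "diag_block_mat (map fst [(Z, ps @ map (map_prod id cnj) ps), (jordan_matrix rs, rs)])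
      = four_block_mat Z (0\<^sub>m n ?m) (0\<^sub>m ?m n) (jordan_matrix rs)"
    using Zc by (auto simp: Let_def intro!: eq_matI)
  moreover have "mat_cnj (four_block_mat Z (0\<^sub>m n ?m) (0\<^sub>m ?m n) (jordan_matrix rs)) =
      four_block_mat Z (0\<^sub>m n ?m) (0\<^sub>m ?m n) (jordan_matrix rs)"
    using Zc Z(1) J by (subst map_four_block_mat[of _ n n _ ?m _ ?m]) auto
  ultimately show ?thesis by auto
qed

lemma eigenvalue_iff_jordan_nf:
  fixes A :: "complex mat"
  assumes A: "A \<in> carrier_mat n n" and nf: "jordan_nf A bs"
  shows "eigenvalue A z \<longleftrightarrow> z \<in> snd ` set bs"
proof -
  have "eigenvalue A z \<longleftrightarrow> poly (char_poly A) z = 0"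
    using eigenvalue_root_char_poly[OF A] .
  also have "\<dots> \<longleftrightarrow> (\<exists>b\<in>set bs. snd b = z \<and> fst b \<noteq> 0)"
    unfolding jordan_nf_char_poly[OF nf]
    by (force simp: poly_prod_list prod_list_zero_iff case_prod_beta)
  also have "\<dots> \<longleftrightarrow> z \<in> snd ` set bs"
    using nf unfolding jordan_nf_def by force
  finally show ?thesis .
qed

lemma real_log_exists:
  assumes A: "A \<in> carrier_mat n n" "mat_cnj A = A" and nf: "jordan_nf A bs"
    and bs: "mset bs = mset (map exp_block (ps @ map (map_prod id cnj) ps @ rs))"
    and rs: "\<And>b. b \<in> set rs \<Longrightarrow> snd b \<in> \<real>"
  obtains X where "X \<in> carrier_mat n n" "mat_cnj X = X" "has_mexp X 1 A"
    "jordan_nf X (ps @ map (map_prod id cnj) ps @ rs)"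
proof -
  let ?cs = "ps @ map (map_prod id cnj) ps @ rs"
  have nf': "jordan_nf A (map exp_block ?cs)" using jordan_nf_mset[OF nf bs] .
  then have nz: "0 \<notin> fst ` set ps" "0 \<notin> fst ` set rs"
    unfolding jordan_nf_def by (force simp: image_image image_Un)+
  obtain Z where Z: "mat_cnj Z = Z" "jordan_nf Z ?cs"
    using real_mat_jordan_nf[OF nz rs] by blast
  obtain E where E: "has_mexp Z 1 E" "jordan_nf E (map exp_block ?cs)"
    using jordan_nf_has_mexp[OF Z(2)] by blast
  have "mat_cnj E = E"
    using has_mexp_unique[OF has_mexp_cnj[OF E(1)]] E(1) Z(1) by simp
  moreover have "similar_mat A E"
    using nf' E(2) similar_mat_trans similar_mat_sym unfolding jordan_nf_def by blast
  ultimately obtain P Q where wit: "similar_mat_wit A E P Q" and real: "mat_cnj P = P" "mat_cnj Q = Q"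
    using similar_mat_real A(2) by metis
  note w = similar_mat_witD2[OF A(1) wit]
  have Z': "Z \<in> carrier_mat n n"
    using E(1) w(5) has_mexpD(1)[OF E(1)] by (metis carrier_matD(1) has_mexp_carrier carrier_matI)
  let ?X = "P * Z * Q"
  have wit': "similar_mat_wit ?X Z P Q"
    using w Z' by (intro similar_mat_witI) auto
  show thesis
  proof
    show "?X \<in> carrier_mat n n" using w Z' by auto
    show "mat_cnj ?X = ?X"
      using mat_cnj_mult[of "P * Z" n n Q n] mat_cnj_mult[of P n n Z n] w Z' real Z(1) by simp
    show "has_mexp ?X 1 A" using has_mexp_similar[OF E(1) wit'] w(3) by simp
    have "similar_mat ?X Z" using wit' unfolding similar_mat_def by blast
    then show "jordan_nf ?X ?cs" using Z(2) similar_mat_trans unfolding jordan_nf_def by blast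
  qed
qed

section \<open>Commutants of a matrix and of its exponential\<close>

lemma has_mexp_eigenvector:
  assumes X: "X \<in> carrier_mat n n" and E: "has_mexp X t E" and v: "eigenvector X v \<mu>"
  shows "E *\<^sub>v v = exp (t * \<mu>) \<cdot>\<^sub>v v"
proof (rule eq_vecI)
  have vc: "v \<in> carrier_vec n" using v X unfolding eigenvector_def by auto
  note E' = has_mexpD[OF E X]
  show "dim_vec (E *\<^sub>v v) = dim_vec (exp (t * \<mu>) \<cdot>\<^sub>v v)" using E'(1) vc by auto
  fix i assume "i < dim_vec (exp (t * \<mu>) \<cdot>\<^sub>v v)"
  then have i: "i < n" using vc by auto
  have "(\<lambda>k. \<Sum>l<n. (X ^\<^sub>m k) $$ (i, l) * t ^ k / fact k * vec_index v l) sums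
      (\<Sum>l<n. E $$ (i, l) * vec_index v l)"
    by (intro sums_sum sums_mult2 E'(2)) (use i in auto)
  moreover have "(\<Sum>l<n. (X ^\<^sub>m k) $$ (i, l) * t ^ k / fact k * vec_index v l) =
      ((t * \<mu>) ^ k /\<^sub>R fact k) * vec_index v i" for k
  proof -
    have "(\<Sum>l<n. (X ^\<^sub>m k) $$ (i, l) * vec_index v l) = vec_index (X ^\<^sub>m k *\<^sub>v v) i"
      using X vc i by (simp add: scalar_prod_def atLeast0LessThan)
    also have "\<dots> = \<mu> ^ k * vec_index v i"
      using eigenvector_pow[OF X v] vc i by simp
    finally have "(\<Sum>l<n. (X ^\<^sub>m k) $$ (i, l) * vec_index v l) = \<mu> ^ k * vec_index v i" .
    moreover have "(\<Sum>l<n. (X ^\<^sub>m k) $$ (i, l) * t ^ k / fact k * vec_index v l) =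
        t ^ k / fact k * (\<Sum>l<n. (X ^\<^sub>m k) $$ (i, l) * vec_index v l)"
      unfolding sum_distrib_left by (intro sum.cong refl) simp
    ultimately show ?thesis
      by (simp add: scaleR_conv_of_real field_simps power_mult_distrib)
  qed
  moreover have "(\<lambda>k. ((t * \<mu>) ^ k /\<^sub>R fact k) * vec_index v i) sums (exp (t * \<mu>) * vec_index v i)"
    by (intro sums_mult2 exp_converges)
  ultimately have "(\<Sum>l<n. E $$ (i, l) * vec_index v l) = exp (t * \<mu>) * vec_index v i"
    using sums_unique2 by simp
  then show "vec_index (E *\<^sub>v v) i = vec_index (exp (t * \<mu>) \<cdot>\<^sub>v v) i"
    using E'(1) vc i by (simp add: scalar_prod_def atLeast0LessThan)
qed

text \<open>Left eigenvectors are treated as eigenvectors of the transpose, so the exponential has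
  to be transposed along with \<open>X\<close>.\<close>

lemma has_mexp_transpose:
  assumes X: "X \<in> carrier_mat n n" and E: "has_mexp X t E"
  shows "has_mexp (transpose_mat X) t (transpose_mat E)"
proof (rule has_mexpI[of _ n])
  note E' = has_mexpD[OF E X]
  show "transpose_mat X \<in> carrier_mat n n" "transpose_mat E \<in> carrier_mat n n" using X E' by auto
  have pow: "transpose_mat X ^\<^sub>m k = transpose_mat (X ^\<^sub>m k)" for k
  proof (induction k)
    case (Suc k)
    have "transpose_mat (X * X ^\<^sub>m k) = transpose_mat (X ^\<^sub>m k) * transpose_mat X"
      by (rule transpose_mult[of _ n n]) (use X in auto)
    then show ?case using Suc pow_mat_comm[OF X] by simp
  qed (use X in auto)
  fix i j assume ij: "i < n" "j < n"
  show "(\<lambda>k. (transpose_mat X ^\<^sub>m k) $$ (i, j) * t ^ k / fact k) sums (transpose_mat E $$ (i, j))"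
    unfolding pow using E'(2)[OF ij(2,1)] ij X E'(1) by simp
qed

text \<open>The rank one matrix built from a right eigenvector of \<open>X\<close> for \<open>\<mu>\<close> and a left one for \<open>\<nu>\<close> commutes
  with \<open>E\<close> but not with \<open>X\<close>; so does its real or its imaginary part.\<close>

lemma commuting_exp_not_commuting:
  assumes X: "X \<in> carrier_mat n n" "mat_cnj X = X" and E: "has_mexp X 1 E"
    and ev: "eigenvalue X \<mu>" "eigenvalue X \<nu>" "\<mu> \<noteq> \<nu>" "exp \<mu> = exp \<nu>"
  obtains C where "C \<in> carrier_mat n n" "mat_cnj C = C" "E * C = C * E" "X * C \<noteq> C * X"
proof -
  note E' = has_mexpD(1)[OF E X(1)]
  have XT: "transpose_mat X \<in> carrier_mat n n" using X by auto
  obtain v where v: "eigenvector X v \<mu>" using ev(1) unfolding eigenvalue_def by blast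
  have "eigenvalue (transpose_mat X) \<nu>"
    using ev(2) eigenvalue_root_char_poly[OF X(1)] eigenvalue_root_char_poly[OF XT]
      char_poly_transpose_mat[OF X(1)] by simp
  then obtain w where w: "eigenvector (transpose_mat X) w \<nu>" unfolding eigenvalue_def by blast
  have vc: "v \<in> carrier_vec n" "v \<noteq> 0\<^sub>v n" "X *\<^sub>v v = \<mu> \<cdot>\<^sub>v v"
    and wc: "w \<in> carrier_vec n" "w \<noteq> 0\<^sub>v n" "transpose_mat X *\<^sub>v w = \<nu> \<cdot>\<^sub>v w"
    using v w X(1) unfolding eigenvector_def by auto
  define K where "K = Matrix.mat n n (\<lambda>(i, j). vec_index v i * vec_index w j)"
  have K: "K \<in> carrier_mat n n" unfolding K_def by simp
  have left: "M * K = c \<cdot>\<^sub>m K" if M: "M \<in> carrier_mat n n" and Mv: "M *\<^sub>v v = c \<cdot>\<^sub>v v" for M c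
  proof (rule eq_matI)
    fix i j assume "i < dim_row (c \<cdot>\<^sub>m K)" "j < dim_col (c \<cdot>\<^sub>m K)"
    then have ij: "i < n" "j < n" using K by auto
    have "(M * K) $$ (i, j) = vec_index (M *\<^sub>v v) i * vec_index w j"
      using M ij vc(1) by (simp add: K_def scalar_prod_def sum_distrib_right mult.assoc)
    then show "(M * K) $$ (i, j) = (c \<cdot>\<^sub>m K) $$ (i, j)" unfolding Mv using ij vc(1) by (simp add: K_def)
  qed (use M K in auto)
  have right: "K * M = c \<cdot>\<^sub>m K" if M: "M \<in> carrier_mat n n" and Mw: "transpose_mat M *\<^sub>v w =
      c \<cdot>\<^sub>v w" for M c
  proof (rule eq_matI)
    fix i j assume "i < dim_row (c \<cdot>\<^sub>m K)" "j < dim_col (c \<cdot>\<^sub>m K)"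
    then have ij: "i < n" "j < n" using K by auto
    have "(K * M) $$ (i, j) = vec_index v i * vec_index (transpose_mat M *\<^sub>v w) j"
      using M ij wc(1) by (simp add: K_def scalar_prod_def sum_distrib_left mult_ac)
    then show "(K * M) $$ (i, j) = (c \<cdot>\<^sub>m K) $$ (i, j)" unfolding Mw using ij wc(1) by (simp add: K_def)
  qed (use M K in auto)
  \<comment> \<open>Both products are \<open>K\<close> times \<open>exp \<mu> = exp \<nu>\<close>,
    whereas \<open>X * K\<close> is \<open>\<mu>\<close> times \<open>K\<close> and
    \<open>K * X\<close> is \<open>\<nu>\<close> times \<open>K\<close>.\<close>
  have EK: "E * K = K * E"
    using left[OF E' has_mexp_eigenvector[OF X(1) E v]]
      right[OF E' has_mexp_eigenvector[OF XT has_mexp_transpose[OF X(1) E] w]] ev(4) by simp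
  have "K \<noteq> 0\<^sub>m n n"
  proof -
    obtain i j where ij: "i < n" "j < n" "vec_index v i \<noteq> 0" "vec_index w j \<noteq> 0"
      using vc(1,2) wc(1,2) by (metis eq_vecI carrier_vecD index_zero_vec)
    then have "K $$ (i, j) \<noteq> 0" by (simp add: K_def)
    then show ?thesis using ij by auto
  qed
  then have "\<mu> \<cdot>\<^sub>m K \<noteq> \<nu> \<cdot>\<^sub>m K"
  proof -
    obtain i j where "i < n" "j < n" "K $$ (i, j) \<noteq> 0"
      using \<open>K \<noteq> 0\<^sub>m n n\<close> K by (metis eq_matI carrier_matD index_zero_mat)
    then show ?thesis using ev(3) K by (metis carrier_matD index_smult_mat(1) mult_right_cancel)
  qed
  then have XK: "X * K \<noteq> K * X" using left[OF X(1) vc(3)] right[OF X(1) wc(3)] by simp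
  define R where "R = K + mat_cnj K"
  define S where "S = \<i> \<cdot>\<^sub>m K + (-\<i>) \<cdot>\<^sub>m mat_cnj K"
  have cK: "mat_cnj K \<in> carrier_mat n n" using K by auto
  have RS: "R \<in> carrier_mat n n" "S \<in> carrier_mat n n" unfolding R_def S_def using K by auto
  have real: "mat_cnj R = R" "mat_cnj S = S"
    unfolding R_def S_def using K by (auto intro!: eq_matI)
  have "mat_cnj E = E"
    using has_mexp_unique[OF has_mexp_cnj[OF E]] E X(2) by simp
  then have EcK: "E * mat_cnj K = mat_cnj K * E"
    using EK mat_cnj_mult[OF E' K] mat_cnj_mult[OF K E'] by simp
  have ER: "E * R = R * E" unfolding R_def
    using mult_add_distrib_mat[OF E' K cK] add_mult_distrib_mat[OF K cK E'] EK EcK by simp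
  have ES: "E * S = S * E"
  proof -
    have "E * S = \<i> \<cdot>\<^sub>m (E * K) + (-\<i>) \<cdot>\<^sub>m (E * mat_cnj K)" unfolding S_def
      using mult_add_distrib_mat[of E n n "\<i> \<cdot>\<^sub>m K" n "(-\<i>) \<cdot>\<^sub>m mat_cnj K"]
        mult_smult_distrib[OF E' K] mult_smult_distrib[OF E' cK] E' K cK by simp
    also have "\<dots> = S * E" unfolding S_def EK EcK
      using add_mult_distrib_mat[of "\<i> \<cdot>\<^sub>m K" n n "(-\<i>) \<cdot>\<^sub>m mat_cnj K" E n]
        mult_smult_assoc_mat[OF K E'] mult_smult_assoc_mat[OF cK E'] E' K cK by simp
    finally show ?thesis .
  qed
  have K2: "K = (1/2) \<cdot>\<^sub>m R + (-\<i>/2) \<cdot>\<^sub>m S"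
    unfolding R_def S_def using K by (intro eq_matI) (auto simp: algebra_simps)
  have "X * R \<noteq> R * X \<or> X * S \<noteq> S * X"
  proof (rule ccontr)
    assume "\<not> ?thesis"
    then have XR: "X * R = R * X" and XS: "X * S = S * X" by auto
    have "X * K = (1/2) \<cdot>\<^sub>m (X * R) + (-\<i>/2) \<cdot>\<^sub>m (X * S)" unfolding K2
      using mult_add_distrib_mat[of X n n "(1/2) \<cdot>\<^sub>m R" n "(-\<i>/2) \<cdot>\<^sub>m S"]
        mult_smult_distrib[OF X(1) RS(1)] mult_smult_distrib[OF X(1) RS(2)] X(1) RS by simp
    also have "\<dots> = K * X" unfolding XR XS K2
      using add_mult_distrib_mat[of "(1/2) \<cdot>\<^sub>m R" n n "(-\<i>/2) \<cdot>\<^sub>m S" X n]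
        mult_smult_assoc_mat[OF RS(1) X(1)] mult_smult_assoc_mat[OF RS(2) X(1)] X(1) RS by simp
    finally show False using XK by simp
  qed
  then show thesis using that RS real ER ES by blast
qed

section \<open>The exponential of real matrices\<close>

abbreviation mat_one :: "real^'n^'n" where
  "mat_one \<equiv> Finite_Cartesian_Product.mat 1"

lemma bij_betw_index: "bij_betw (from_nat_into UNIV) {..<CARD('n)} (UNIV :: 'n::finite set)"
  by (rule bij_betw_from_nat_into_finite) simp

lemma complex_mat_carrier [simp]: "complex_mat (A :: real^'n^'n) \<in> carrier_mat CARD('n) CARD('n)"
  by (simp add: complex_mat_def)

lemma complex_mat_dim [simp]:
  "dim_row (complex_mat (A :: real^'n^'n)) = CARD('n)" "dim_col (complex_mat A) = CARD('n)"
  by (simp_all add: complex_mat_def)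

lemma complex_mat_index:
  fixes A :: "real^'n^'n"
  assumes "i < CARD('n)" "j < CARD('n)"
  shows "complex_mat A $$ (i, j) = complex_of_real (vec_nth (vec_nth A (from_nat_into UNIV i))
      (from_nat_into UNIV j))"
  using assms by (simp add: complex_mat_def)

lemma complex_mat_index_to_nat:
  fixes a b :: "'n::finite"
  obtains i j where "i < CARD('n)" "j < CARD('n)"
    "\<And>A :: real^'n^'n. complex_mat A $$ (i, j) = complex_of_real (vec_nth (vec_nth A a) b)"
proof -
  have "a \<in> from_nat_into UNIV ` {..<CARD('n)}" "b \<in> from_nat_into UNIV ` {..<CARD('n)}"
    using bij_betw_imp_surj_on[OF bij_betw_index[where 'n='n]] by simp_all
  then obtain i j where "i < CARD('n)" "j < CARD('n)" "from_nat_into UNIV i = a"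
      "from_nat_into UNIV j = b"
    by auto
  then show thesis using that[of i j] complex_mat_index[of i j, where 'n='n] by simp
qed

lemma complex_mat_inj: "complex_mat A = complex_mat B \<longleftrightarrow> A = B"
proof
  assume eq: "complex_mat A = complex_mat B"
  have "vec_nth (vec_nth A a) b = vec_nth (vec_nth B a) b" for a b
  proof (rule complex_mat_index_to_nat[of a b])
    fix i j assume "\<And>A. complex_mat A $$ (i, j) = complex_of_real (vec_nth (vec_nth A a) b)"
    from this[of A] this[of B] show ?thesis using eq by simp
  qed
  then show "A = B" by (simp add: Finite_Cartesian_Product.vec_eq_iff)
qed simp

lemma complex_mat_mult: "complex_mat (A ** B) = complex_mat A * complex_mat (B :: real^'n^'n)"
proof (rule eq_matI)
  fix i j assume "i < dim_row (complex_mat A * complex_mat B)"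
      "j < dim_col (complex_mat A * complex_mat B)"
  then have ij: "i < CARD('n)" "j < CARD('n)" by simp_all
  then show "complex_mat (A ** B) $$ (i, j) = (complex_mat A * complex_mat B) $$ (i, j)"
    using sum.reindex_bij_betw[OF bij_betw_index[where 'n='n],
        of "\<lambda>k. vec_nth (vec_nth A (from_nat_into UNIV i)) k * vec_nth (vec_nth B k) (from_nat_into
            UNIV j)"]
    by (simp add: complex_mat_index matrix_matrix_mult_def scalar_prod_def atLeast0LessThan
        flip: of_real_mult of_real_sum)
qed simp_all

lemma complex_mat_one: "complex_mat (mat_one :: real^'n^'n) = 1\<^sub>m CARD('n)"
proof (rule eq_matI)
  fix i j assume "i < dim_row (1\<^sub>m CARD('n) :: complex mat)" "j < dim_col (1\<^sub>m CARD('n) :: complex mat)"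
  then have ij: "i < CARD('n)" "j < CARD('n)" by simp_all
  then have "(from_nat_into UNIV i = (from_nat_into UNIV j :: 'n)) \<longleftrightarrow> i = j"
    using bij_betw_imp_inj_on[OF bij_betw_index[where 'n='n]] by (auto simp: inj_on_def)
  then show "complex_mat (mat_one :: real^'n^'n) $$ (i, j) = 1\<^sub>m CARD('n) $$ (i, j)"
    using ij by (simp add: complex_mat_index Finite_Cartesian_Product.mat_def)
qed simp_all

lemma mat_cnj_complex_mat [simp]: "mat_cnj (complex_mat A) = complex_mat A"
  by (rule eq_matI) (simp_all add: complex_mat_index)

lemma complex_mat_surj:
  assumes "M \<in> carrier_mat CARD('n::finite) CARD('n)" "mat_cnj M = M"
  obtains A :: "real^'n^'n" where "complex_mat A = M"
proof
  let ?g = "inv_into {..<CARD('n)} (from_nat_into (UNIV :: 'n set))"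
  let ?A = "\<chi> a b. Re (M $$ (?g a, ?g b)) :: real^'n^'n"
  show "complex_mat ?A = M"
  proof (rule eq_matI)
    fix i j assume "i < dim_row M" "j < dim_col M"
    then have ij: "i < CARD('n)" "j < CARD('n)" using assms(1) by auto
    then have "?g (from_nat_into UNIV i) = i" "?g (from_nat_into UNIV j) = j"
      using bij_betw_imp_inj_on[OF bij_betw_index[where 'n='n]] by (simp_all add: inv_into_f_f)
    moreover have "cnj (M $$ (i, j)) = M $$ (i, j)"
      using assms ij by (metis carrier_matD index_map_mat(1))
    then have "complex_of_real (Re (M $$ (i, j))) = M $$ (i, j)" by (simp add: complex_eq_iff)
    ultimately show "complex_mat ?A $$ (i, j) = M $$ (i, j)" using ij by (simp add: complex_mat_index)
  qed (use assms in auto)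
qed

section \<open>Convergence, derivative and functional equation\<close>

text \<open>Multiplication, powers and \<open>1\<close> of the type \<open>real^'n^'n\<close> are
  entrywise, hence a separate recursion for matrix powers and \<open>mat_one\<close> for the
  identity.\<close>

primrec mpow :: "real^'n^'n \<Rightarrow> nat \<Rightarrow> real^'n^'n" where
  "mpow X 0 = mat_one"
| "mpow X (Suc k) = mpow X k ** X"

lemma complex_mat_mpow: "complex_mat (mpow X k) = complex_mat X ^\<^sub>m k"
  by (induction k) (simp_all add: complex_mat_one complex_mat_mult)

lemma mpow_comm: "X ** mpow X k = mpow X k ** X"
  by (induction k) (simp_all add: matrix_mul_assoc)

definition rexp :: "real^'n^'n \<Rightarrow> real \<Rightarrow> real^'n^'n" where
  "rexp X t = (\<chi> i j. \<Sum>k. vec_nth (vec_nth (mpow X k) i) j * t ^ k / fact k)"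

lemma finite_eigenvalues:
  assumes "(A :: complex mat) \<in> carrier_mat n n"
  shows "finite {z. eigenvalue A z}"
proof -
  have "char_poly A \<noteq> 0" using degree_monic_char_poly[OF assms] by auto
  then show ?thesis
    using poly_roots_finite by (simp add: eigenvalue_root_char_poly[OF assms])
qed

lemma has_mexp_exists:
  assumes A: "A \<in> carrier_mat n n"
  shows "\<exists>E. has_mexp A t E"
proof (rule has_mexp_exppoly[OF A finite_eigenvalues[OF A]])
  fix E assume "\<And>t. has_mexp A t (E t)"
  then show ?thesis by blast
qed simp

text \<open>\<open>rexp\<close> is defined by infinite sums, which are meaningful only if they
  converge. Convergence is inherited from the complex exponential, which exists through the Jordan
  form.\<close>

lemma rexp_sums:
  "(\<lambda>k. vec_nth (vec_nth (mpow X k) i) j * t ^ k / fact k) sums vec_nth (vec_nth (rexp X t) i) j"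
proof -
  obtain E where E: "has_mexp (complex_mat X) (of_real t) E"
    using has_mexp_exists[OF complex_mat_carrier] by blast
  obtain a b where ab: "a < CARD('a)" "b < CARD('a)"
    "\<And>A :: real^'a^'a. complex_mat A $$ (a, b) = complex_of_real (vec_nth (vec_nth A i) j)"
    using complex_mat_index_to_nat[of i j] by blast
  have "(\<lambda>k. complex_of_real (vec_nth (vec_nth (mpow X k) i) j * t ^ k / fact k)) sums E $$ (a, b)"
    using has_mexpD(2)[OF E complex_mat_carrier ab(1,2)]
    by (simp add: ab(3) complex_mat_mpow[symmetric])
  then have "summable (\<lambda>k. complex_of_real (vec_nth (vec_nth (mpow X k) i) j * t ^ k / fact k))"
    by (rule sums_summable)
  then have "summable (\<lambda>k. vec_nth (vec_nth (mpow X k) i) j * t ^ k / fact k)"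
    by (simp only: summable_complex_of_real)
  then show ?thesis by (simp add: rexp_def summable_sums)
qed

lemma has_mexp_complex_mat: "has_mexp (complex_mat X) (of_real t) (complex_mat (rexp X t))"
proof (rule has_mexpI[OF complex_mat_carrier complex_mat_carrier])
  fix i j assume ij: "i < CARD('a)" "j < CARD('a)"
  have "(\<lambda>k. complex_of_real (vec_nth (vec_nth (mpow X k) (from_nat_into UNIV i)) (from_nat_into
      UNIV j) * t ^ k / fact k))
      sums complex_of_real (vec_nth (vec_nth (rexp X t) (from_nat_into UNIV i)) (from_nat_into UNIV j))"
    by (simp only: sums_of_real_iff rexp_sums)
  then show "(\<lambda>k. (complex_mat X ^\<^sub>m k) $$ (i, j) * complex_of_real t ^ k / fact k) sums
      complex_mat (rexp X t) $$ (i, j)"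
    using ij by (simp add: complex_mat_index flip: complex_mat_mpow)
qed

lemma rexp_eq_iff: "rexp X t = A \<longleftrightarrow> has_mexp (complex_mat X) (of_real t) (complex_mat A)"
proof
  assume "has_mexp (complex_mat X) (of_real t) (complex_mat A)"
  from has_mexp_unique[OF has_mexp_complex_mat this] show "rexp X t = A"
    by (simp only: complex_mat_inj)
qed (use has_mexp_complex_mat in blast)

lemma rexp_similar:
  assumes "P ** Q = mat_one" "Q ** P = mat_one"
  shows "rexp (P ** X ** Q) t = P ** rexp X t ** (Q :: real^'n^'n)"
proof -
  have "similar_mat_wit (complex_mat (P ** X ** Q)) (complex_mat X) (complex_mat P) (complex_mat Q)"
  proof (intro similar_mat_witI[of _ _ "CARD('n)"])
    show PQ: "complex_mat P * complex_mat Q = 1\<^sub>m CARD('n)" "complex_mat Q * complex_mat P =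
        1\<^sub>m CARD('n)"
      using assms by (simp_all flip: complex_mat_mult complex_mat_one)
    show "complex_mat (P ** X ** Q) = complex_mat P * complex_mat X * complex_mat Q"
      by (simp only: complex_mat_mult)
  qed (rule complex_mat_carrier)+
  from has_mexp_similar[OF has_mexp_complex_mat this] show ?thesis
    by (simp add: rexp_eq_iff complex_mat_mult)
qed

lemma bounded_bilinear_matrix_mult: "bounded_bilinear ((**) :: real^'n^'n \<Rightarrow> real^'n^'n \<Rightarrow> real^'n^'n)"
  unfolding bilinear_conv_bounded_bilinear[symmetric] bilinear_def
  by (auto intro!: linearI
      simp: Finite_Cartesian_Product.vec_eq_iff matrix_matrix_mult_def algebra_simps sum.distrib
          sum_distrib_left)

interpretation matmul: bounded_bilinear "(**) :: real^'n^'n \<Rightarrow> real^'n^'n \<Rightarrow> real^'n^'n"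
  by (rule bounded_bilinear_matrix_mult)

lemma rexp_sums_matrix: "(\<lambda>k. (t ^ k / fact k) *\<^sub>R mpow X k) sums rexp X t"
  unfolding sums_def
proof (intro vec_tendstoI)
  fix i j
  show "((\<lambda>n. vec_nth (vec_nth (\<Sum>k<n. (t ^ k / fact k) *\<^sub>R mpow X k) i) j) \<longlongrightarrow> vec_nth (vec_nth (rexp
      X t) i) j) sequentially"
    using rexp_sums[of X i j t] by (simp add: sums_def mult.commute)
qed

lemma rexp_comm: "X ** rexp X t = rexp X t ** X"
proof (rule sums_unique2)
  show "(\<lambda>k. X ** ((t ^ k / fact k) *\<^sub>R mpow X k)) sums (X ** rexp X t)"
    by (rule matmul.bounded_linear_right[THEN bounded_linear.sums, OF rexp_sums_matrix])
  show "(\<lambda>k. X ** ((t ^ k / fact k) *\<^sub>R mpow X k)) sums (rexp X t ** X)"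
    using matmul.bounded_linear_left[THEN bounded_linear.sums, OF rexp_sums_matrix, of t X X]
    by (simp add: matmul.scaleR_left matmul.scaleR_right mpow_comm)
qed

lemma has_vector_derivative_matrixI:
  fixes f :: "real \<Rightarrow> real^'n^'n"
  assumes "\<And>i j. ((\<lambda>t. vec_nth (vec_nth (f t) i) j) has_real_derivative vec_nth (vec_nth f' i) j)
      (at t)"
  shows "(f has_vector_derivative f') (at t)"
  unfolding has_vector_derivative_def has_derivative_componentwise_within[of f]
proof
  fix b :: "real^'n^'n" assume "b \<in> Basis"
  then obtain i j where b: "b = axis i (axis j 1)" by (auto simp: Basis_vec_def)
  show "((\<lambda>x. f x \<bullet> b) has_derivative (\<lambda>x. x *\<^sub>R f' \<bullet> b)) (at t)"
  proof -
    have "(\<lambda>x. x *\<^sub>R f' \<bullet> b) = (*) (vec_nth (vec_nth f' i) j)" "(\<lambda>x. f x \<bullet> b) =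
        (\<lambda>x. vec_nth (vec_nth (f x) i) j)"
      unfolding b by (auto simp: inner_axis)
    then show ?thesis using assms[of i j] unfolding has_field_derivative_def by simp
  qed
qed

lemma rexp_has_vector_derivative: "(rexp X has_vector_derivative rexp X t ** X) (at t)"
proof (rule has_vector_derivative_matrixI)
  fix i j
  let ?c = "\<lambda>k. vec_nth (vec_nth (mpow X k) i) j / fact k"
  have s: "(\<lambda>k. ?c k * y ^ k) sums vec_nth (vec_nth (rexp X y) i) j" for y
    using rexp_sums[of X i j y] by simp
  have "((\<lambda>x. \<Sum>k. ?c k * x ^ k) has_real_derivative (\<Sum>k. diffs ?c k * t ^ k)) (at t)"
    by (rule termdiffs_strong_converges_everywhere) (rule sums_summable[OF s])
  moreover have "(\<lambda>x. \<Sum>k. ?c k * x ^ k) = (\<lambda>x. vec_nth (vec_nth (rexp X x) i) j)"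
    using sums_unique[OF s] by (simp add: fun_eq_iff)
  moreover have "(\<lambda>k. diffs ?c k * t ^ k) sums vec_nth (vec_nth (rexp X t ** X) i) j"
  proof -
    have "(\<lambda>k. vec_nth (vec_nth (((t ^ k / fact k) *\<^sub>R mpow X k) ** X) i) j) sums
        vec_nth (vec_nth (rexp X t ** X) i) j"
      by (intro bounded_linear.sums[OF bounded_linear_vec_nth]
          matmul.bounded_linear_left[THEN bounded_linear.sums, OF rexp_sums_matrix])
    \<comment> \<open>\<open>diffs\<close> shifts the coefficients by one; its factor
      \<open>k + 1\<close> cancels against \<open>fact (k + 1)\<close> and leaves the entry of
      \<open>mpow X (k + 1)\<close> over \<open>fact k\<close>.\<close>
    moreover have "vec_nth (vec_nth (((t ^ k / fact k) *\<^sub>R mpow X k) ** X) i) j =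
        diffs ?c k * t ^ k" for k
      by (simp add: matmul.scaleR_left diffs_def fact_Suc del: of_nat_Suc)
    ultimately show ?thesis by simp
  qed
  then have "(\<Sum>k. diffs ?c k * t ^ k) = vec_nth (vec_nth (rexp X t ** X) i) j"
    by (simp add: sums_iff)
  ultimately show "((\<lambda>t. vec_nth (vec_nth (rexp X t) i) j) has_real_derivative vec_nth (vec_nth
      (rexp X t ** X) i) j) (at t)"
    by simp
qed

lemma rexp_zero [simp]: "rexp X 0 = mat_one"
proof -
  have "(\<lambda>k. (0 ^ k / fact k) *\<^sub>R mpow X k) sums (\<Sum>k\<in>{0}. (0 ^ k / fact k) *\<^sub>R mpow X k)"
    by (rule sums_finite) auto
  from sums_unique2[OF rexp_sums_matrix[of 0 X] this] show ?thesis by simp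
qed

lemma rexp_chain:
  assumes "(g has_real_derivative g') (at t)"
  shows "((\<lambda>t. rexp X (g t)) has_vector_derivative g' *\<^sub>R (rexp X (g t) ** X)) (at t)"
  using vector_diff_chain_at[OF _ rexp_has_vector_derivative, of g g' t X] assms
  by (simp add: o_def has_real_derivative_iff_has_vector_derivative)

lemma constant_if_derivative_zero:
  fixes f :: "real \<Rightarrow> 'a::real_normed_vector"
  assumes "\<And>t. (f has_vector_derivative 0) (at t)"
  shows "f s = f t"
proof -
  obtain c where "\<And>x. x \<in> UNIV \<Longrightarrow> f x = c"
    using has_vector_derivative_zero_constant[OF convex_UNIV, of f] assms by auto
  then show ?thesis by simp
qed

text \<open>The group law comes from differentiation rather than from multiplying series:
  \<open>X\<close> commutes with its exponential, so the product has derivative 0.\<close>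

lemma rexp_minus: "rexp X t ** rexp X (- t) = mat_one"
proof -
  let ?f = "\<lambda>t. rexp X t ** rexp X (- t)"
  have "(?f has_vector_derivative 0) (at t)" for t
  proof -
    have "(?f has_vector_derivative rexp X t ** ((-1) *\<^sub>R (rexp X (- t) ** X)) +
        (rexp X t ** X) ** rexp X (- t)) (at t)"
      by (intro matmul.has_vector_derivative rexp_has_vector_derivative rexp_chain)
        (auto intro!: derivative_eq_intros)
    then show ?thesis
      by (simp add: matmul.minus_right matrix_mul_assoc[symmetric] rexp_comm[of X "- t"])
  qed
  then have "?f t = ?f 0" by (rule constant_if_derivative_zero)
  then show ?thesis by simp
qed

lemma rexp_minus': "rexp X (- t) ** rexp X t = mat_one"
  using rexp_minus[of X "- t"] by simp

lemma rexp_add: "rexp X (s + t) = rexp X s ** rexp X t"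
proof -
  let ?f = "\<lambda>t. rexp X (s + t) ** rexp X (- t)"
  have "(?f has_vector_derivative 0) (at t)" for t
  proof -
    have "(?f has_vector_derivative rexp X (s + t) ** ((-1) *\<^sub>R (rexp X (- t) ** X)) +
        (1 *\<^sub>R (rexp X (s + t) ** X)) ** rexp X (- t)) (at t)"
      by (intro matmul.has_vector_derivative rexp_chain) (auto intro!: derivative_eq_intros)
    then show ?thesis
      by (simp add: matmul.minus_right matrix_mul_assoc[symmetric] rexp_comm[of X "- t"])
  qed
  then have "?f t = ?f 0" by (rule constant_if_derivative_zero)
  then have "rexp X (s + t) ** (rexp X (- t) ** rexp X t) = rexp X s ** rexp X t"
    by (simp add: matrix_mul_assoc)
  then show ?thesis by (simp add: rexp_minus')
qed

lemma rexp_of_nat: "rexp X (of_nat m) = mpow (rexp X 1) m"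
proof (induction m)
  case (Suc m)
  have "rexp X (of_nat (Suc m)) = rexp X (of_nat m) ** rexp X 1"
    by (simp add: add.commute[of 1] rexp_add)
  then show ?case using Suc by simp
qed simp

section \<open>Geodesics of the general linear group\<close>

lemma matrix_inv_inverse:
  assumes "invertible (A :: real^'n^'n)"
  shows "A ** matrix_inv A = mat_one" "matrix_inv A ** A = mat_one"
  using someI_ex[OF assms[unfolded invertible_def]] unfolding matrix_inv_def by auto

lemma eventually_invertible:
  assumes "invertible (p :: real^'n^'n)"
  shows "\<forall>\<^sub>F q in nhds p. invertible q"
proof -
  have "continuous_on UNIV (Determinants.det :: real^'n^'n \<Rightarrow> real)"
    unfolding Determinants.det_def[abs_def] by (intro continuous_intros)
  then have "open {q :: real^'n^'n. Determinants.det q \<noteq> 0}"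
    by (intro open_Collect_neq) auto
  then show ?thesis
    using assms by (auto simp: invertible_det_nz eventually_nhds)
qed

text \<open>With \<open>Q\<close> and \<open>B\<close> the inverses of \<open>p + h\<close> and
  \<open>p\<close>, one has \<open>Q = B - Q h B\<close>. Used twice, this writes the error as
  \<open>Q h B h B\<close>, quadratic in \<open>h\<close>; for small \<open>h\<close> it also bounds
  the norm of \<open>Q\<close>.\<close>

lemma has_derivative_matrix_inv:
  fixes p :: "real^'n^'n"
  assumes p: "invertible p"
  shows "(matrix_inv has_derivative (\<lambda>h. - (matrix_inv p ** h ** matrix_inv p))) (at p)"
  unfolding has_derivative_at
proof
  let ?B = "matrix_inv p"
  show "bounded_linear (\<lambda>h. - (?B ** h ** ?B))"
    by (intro bounded_linear_minus
        bounded_linear_compose[OF matmul.bounded_linear_left matmul.bounded_linear_right])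
  obtain K where K: "K > 0" "\<And>(X :: real^'n^'n) (Y :: real^'n^'n). norm (X ** Y) \<le> norm X * norm Y * K"
    using matmul.pos_bounded by blast
  have lim: "((\<lambda>h::real^'n^'n. norm h * (norm ?B * K * K)) \<longlongrightarrow> 0) (at 0)"
    by (intro tendsto_eq_intros) auto
  have ev1: "\<forall>\<^sub>F h in at (0 :: real^'n^'n). norm h * (norm ?B * K * K) < 1/2"
    using order_tendstoD(2)[OF lim, of "1/2"] by simp
  have ev2: "\<forall>\<^sub>F h in at (0 :: real^'n^'n). invertible (p + h)"
  proof -
    have "((\<lambda>h. p + h) \<longlongrightarrow> p) (at 0)" by (intro tendsto_eq_intros) auto
    then show ?thesis using eventually_invertible[OF p] by (metis filterlim_iff)
  qed
  \<comment> \<open>\<open>2 * norm ?B\<close> bounds the inverse of \<open>p + h\<close>, the other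
    two norms belong to the two factors \<open>?B\<close> of the error, and each of its four
    products costs one \<open>K\<close>.\<close>
  let ?c = "2 * norm ?B * K * norm ?B * K * norm ?B * K * K"
  show "((\<lambda>h. norm (matrix_inv (p + h) - ?B - - (?B ** h ** ?B)) / norm h) \<longlongrightarrow> 0) (at 0)"
  proof (rule Lim_null_comparison)
    show "((\<lambda>h::real^'n^'n. ?c * norm h) \<longlongrightarrow> 0) (at 0)"
      by (intro tendsto_eq_intros) auto
    show "\<forall>\<^sub>F h in at (0 :: real^'n^'n). norm (norm (matrix_inv (p +
        h) - ?B - - (?B ** h ** ?B)) / norm h) \<le> ?c * norm h"
      using ev1 ev2
    proof eventually_elim
      case (elim h)
      let ?Q = "matrix_inv (p + h)"
      have "?Q = ?Q ** ((p + h) ** ?B - h ** ?B)"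
        using matrix_inv_inverse[OF p] by (simp add: matmul.add_left)
      also have "\<dots> = ?B - ?Q ** h ** ?B"
        using matrix_inv_inverse[OF elim(2)] by (simp add: matmul.diff_right matrix_mul_assoc)
      finally have Q: "?Q = ?B - ?Q ** h ** ?B" .
      have "norm (?Q ** h ** ?B) \<le> norm (?Q ** h) * norm ?B * K" by (rule K)
      also have "\<dots> \<le> (norm ?Q * norm h * K) * norm ?B * K"
        using K by (intro mult_right_mono) auto
      also have "\<dots> = norm ?Q * (norm h * (norm ?B * K * K))" by simp
      also have "\<dots> \<le> norm ?Q * (1/2)" using elim(1) by (intro mult_left_mono) auto
      finally have "norm (?Q ** h ** ?B) \<le> norm ?Q / 2" by simp
      then have nQ: "norm ?Q \<le> 2 * norm ?B"
        using norm_triangle_ineq4[of ?B "?Q ** h ** ?B"] Q by simp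
      have "?Q - ?B - - (?B ** h ** ?B) = (?B - ?Q) ** h ** ?B"
        using Q by (simp add: matmul.diff_left algebra_simps)
      also have "?B - ?Q = ?Q ** h ** ?B"
        using Q by (metis add_diff_cancel_left' diff_add_cancel)
      finally have "norm (?Q - ?B - - (?B ** h ** ?B)) = norm (?Q ** h ** ?B ** h ** ?B)" by simp
      also have "\<dots> \<le> norm (?Q ** h ** ?B ** h) * norm ?B * K" by (rule K)
      also have "\<dots> \<le> (norm (?Q ** h ** ?B) * norm h * K) * norm ?B * K"
        using K by (intro mult_right_mono) auto
      also have "\<dots> \<le> ((norm (?Q ** h) * norm ?B * K) * norm h * K) * norm ?B * K"
        using K by (intro mult_right_mono) auto
      also have "\<dots> \<le> (((norm ?Q * norm h * K) * norm ?B * K) * norm h * K) * norm ?B * K"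
        using K by (intro mult_right_mono) auto
      also have "\<dots> \<le> (((2 * norm ?B * norm h * K) * norm ?B * K) * norm h * K) * norm ?B * K"
        using K nQ by (intro mult_right_mono) auto
      also have "\<dots> = ?c * norm h * norm h" by simp
      finally show ?case
        by (cases "h = 0") (simp_all add: divide_le_eq)
    qed
  qed
qed

lemma bounded_linear_trace: "bounded_linear (trace :: real^'n^'n \<Rightarrow> real)"
  unfolding linear_conv_bounded_linear[symmetric] trace_def[abs_def]
  by (auto intro!: linearI simp: sum.distrib sum_distrib_left)

lemma frechet_derivative_gl_metric:
  fixes p :: "real^'n^'n"
  assumes p: "invertible p"
  shows "frechet_derivative (\<lambda>q. gl_metric q v w) (at p) u =
    - trace (matrix_inv p ** u ** matrix_inv p ** v ** matrix_inv p ** w)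
    - trace (matrix_inv p ** v ** matrix_inv p ** u ** matrix_inv p ** w)"
proof -
  let ?B = "matrix_inv p"
  note d = has_derivative_matrix_inv[OF p]
  have 1: "((\<lambda>q. matrix_inv q ** v) has_derivative (\<lambda>h. - (?B ** h ** ?B) ** v)) (at p)"
    using bounded_linear.has_derivative[OF matmul.bounded_linear_left d] .
  have 2: "((\<lambda>q. matrix_inv q ** v ** matrix_inv q) has_derivative
      (\<lambda>h. ?B ** v ** (- (?B ** h ** ?B)) + - (?B ** h ** ?B) ** v ** ?B)) (at p)"
    by (rule matmul.FDERIV[OF 1 d])
  have 3: "((\<lambda>q. trace (matrix_inv q ** v ** matrix_inv q ** w)) has_derivative
      (\<lambda>h. trace ((?B ** v ** (- (?B ** h ** ?B)) + - (?B ** h ** ?B) ** v ** ?B) ** w))) (at p)"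
    by (intro bounded_linear.has_derivative[OF bounded_linear_trace]
        bounded_linear.has_derivative[OF matmul.bounded_linear_left] 2)
  show ?thesis
    unfolding gl_metric_def frechet_derivative_at[OF 3, symmetric]
    by (simp add: matmul.minus_left matmul.minus_right matmul.add_left matmul.diff_left matrix_mul_assoc
        linear_add[OF bounded_linear.linear[OF bounded_linear_trace]]
        linear_diff[OF bounded_linear.linear[OF bounded_linear_trace]]
        linear_neg[OF bounded_linear.linear[OF bounded_linear_trace]])
qed

lemma trace_nondegenerate:
  assumes "\<And>w :: real^'n^'n. trace (M ** w) = 0"
  shows "M = 0"
proof -
  have "trace (M ** Finite_Cartesian_Product.transpose M) = M \<bullet> M"
    by (simp add: trace_def matrix_matrix_mult_def Finite_Cartesian_Product.transpose_def inner_vec_def)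
  then show ?thesis using assms by simp
qed

text \<open>With \<open>T\<close> the trace of
  \<open>p\<inverse> v p\<inverse> v p\<inverse> w\<close>, cyclicity makes each of the three
  derivatives in the Koszul formula equal to \<open>- 2 T\<close>, so that it yields
  \<open>- T\<close>. That is the metric applied to \<open>- v p\<inverse> v\<close> and
  \<open>w\<close>.\<close>

lemma christoffel_gl_metric:
  fixes p :: "real^'n^'n"
  assumes p: "invertible p"
  shows "christoffel gl_metric p v v = - (v ** matrix_inv p ** v)"
  unfolding christoffel_def
proof (rule the_equality)
  let ?B = "matrix_inv p"
  have cyc: "trace (?B ** w ** ?B ** v ** ?B ** v) = trace (?B ** v ** ?B ** v ** ?B ** w)"
    "trace (?B ** v ** ?B ** w ** ?B ** v) = trace (?B ** v ** ?B ** v ** ?B ** w)" for w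
    using trace_mul_sym[of "?B ** w" "?B ** v ** ?B ** v"] trace_mul_sym[of "?B ** v ** ?B ** w"
        "?B ** v"]
    by (simp_all add: matrix_mul_assoc)
  have first: "christoffel_first gl_metric p v v w = - trace (?B ** v ** ?B ** v ** ?B ** w)" for w
    unfolding christoffel_first_def frechet_derivative_gl_metric[OF p] cyc by simp
  show sol: "\<forall>w. gl_metric p (- (v ** ?B ** v)) w = christoffel_first gl_metric p v v w"
    unfolding first gl_metric_def
    by (simp add: matmul.minus_left matmul.minus_right matrix_mul_assoc
        linear_neg[OF bounded_linear.linear[OF bounded_linear_trace]])
  fix x assume "\<forall>w. gl_metric p x w = christoffel_first gl_metric p v v w"
  then have "gl_metric p x w - gl_metric p (- (v ** ?B ** v)) w = 0" for w
    using sol by simp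
  then have "trace (?B ** (x - - (v ** ?B ** v)) ** ?B ** w) = 0" for w
    unfolding gl_metric_def
    by (simp only: matmul.diff_left matmul.diff_right linear_diff[OF bounded_linear.linear[OF
        bounded_linear_trace]])
  then have "?B ** (x - - (v ** ?B ** v)) ** ?B = 0" by (rule trace_nondegenerate)
  then have "p ** (?B ** (x - - (v ** ?B ** v)) ** ?B) ** p = 0" by (simp add:
      matmul.zero_left matmul.zero_right)
  moreover have "p ** (?B ** Z ** ?B) ** p = Z" for Z :: "real^'n^'n"
  proof -
    have "p ** (?B ** Z ** ?B) ** p = (p ** ?B) ** Z ** (?B ** p)" by (simp only: matrix_mul_assoc)
    then show ?thesis by (simp add: matrix_inv_inverse[OF p])
  qed
  ultimately have "x - - (v ** ?B ** v) = 0" by metis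
  then show "x = - (v ** ?B ** v)" by (simp only: right_minus_eq)
qed

section \<open>Geodesics as exponential curves\<close>

lemma derivative_zero_unit_interval:
  fixes f :: "real \<Rightarrow> 'a::real_normed_vector"
  assumes "\<And>t. t \<in> {0..1} \<Longrightarrow> (f has_vector_derivative 0) (at t within {0..1})" "t \<in> {0..1}"
  shows "f t = f 0"
proof -
  obtain c where "\<And>x. x \<in> {0..1} \<Longrightarrow> f x = c"
    using has_vector_derivative_zero_constant[of "{0..1}" f] assms(1) by auto
  then show ?thesis using assms(2) by simp
qed

lemma geodesic_gl_eq_exp:
  fixes \<gamma> :: "real \<Rightarrow> real^'n^'n"
  assumes g: "geodesic_on gl_metric GL {0..1} \<gamma>"
  shows "\<exists>X. \<forall>t\<in>{0..1}. \<gamma> t = \<gamma> 0 ** rexp X t"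
proof -
  let ?I = "{0..1::real}"
  from g obtain D where D0: "D 0 = \<gamma>"
    and DS: "\<forall>k. \<forall>t\<in>?I. (D k has_vector_derivative D (Suc k) t) (at t within ?I)"
    and D2: "\<forall>t\<in>?I. D 2 t + christoffel gl_metric (\<gamma> t) (D 1 t) (D 1 t) = 0"
    unfolding geodesic_on_def by (elim conjE exE)
  note D = D0 DS[rule_format] D2[rule_format]
  have inv: "invertible (\<gamma> t)" if "t \<in> ?I" for t
    using g that by (auto simp: geodesic_on_def GL_def image_subset_iff)
  have d1: "(\<gamma> has_vector_derivative D 1 t) (at t within ?I)" if "t \<in> ?I" for t
    using D(2)[OF that, of 0] D(1) by simp
  have d2: "(D 1 has_vector_derivative D 1 t ** matrix_inv (\<gamma> t) ** D 1 t) (at t within ?I)"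
      if "t \<in> ?I" for t
    using D(2)[OF that, of 1] D(3)[OF that] christoffel_gl_metric[OF inv[OF that]]
    by (simp add: numeral_2_eq_2)
  define X where "X = matrix_inv (\<gamma> 0) ** D 1 0"
  have Y: "matrix_inv (\<gamma> t) ** D 1 t = X" if t: "t \<in> ?I" for t
    unfolding X_def
  proof (rule derivative_zero_unit_interval[OF _ t])
    fix t assume t: "t \<in> ?I"
    let ?B = "matrix_inv (\<gamma> t)"
    have "((\<lambda>s. matrix_inv (\<gamma> s)) has_vector_derivative - (?B ** D 1 t ** ?B)) (at t within ?I)"
      using has_derivative_compose[OF d1[OF t, unfolded has_vector_derivative_def]
          has_derivative_matrix_inv[OF inv[OF t]]]
      unfolding has_vector_derivative_def by (simp add: matmul.scaleR_left matmul.scaleR_right)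
    from matmul.has_vector_derivative[OF this d2[OF t]]
    show "((\<lambda>s. matrix_inv (\<gamma> s) ** D 1 s) has_vector_derivative 0) (at t within ?I)"
      by (simp add: matmul.minus_left matrix_mul_assoc)
  qed
  have D1: "D 1 t = \<gamma> t ** X" if "t \<in> ?I" for t
    using Y[OF that, symmetric] matrix_inv_inverse[OF inv[OF that]] by (simp add: matrix_mul_assoc)
  \<comment> \<open>Uniqueness for the linear equation \<open>\<gamma>' = \<gamma> X\<close>: the
    product with \<open>rexp X (- t)\<close> has derivative 0.\<close>
  have "\<gamma> t = \<gamma> 0 ** rexp X t" if t: "t \<in> ?I" for t
  proof -
    have "\<gamma> t ** rexp X (- t) = \<gamma> 0 ** rexp X (- 0)"
    proof (rule derivative_zero_unit_interval[OF _ t])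
      fix t assume t: "t \<in> ?I"
      have "((\<lambda>t. rexp X (- t)) has_vector_derivative (-1) *\<^sub>R (rexp X (- t) ** X)) (at t within ?I)"
        by (rule has_vector_derivative_at_within, rule rexp_chain) (auto intro!: derivative_eq_intros)
      from matmul.has_vector_derivative[OF d1[OF t] this]
      show "((\<lambda>t. \<gamma> t ** rexp X (- t)) has_vector_derivative 0) (at t within ?I)"
        by (simp add: D1[OF t, simplified] matmul.minus_right matrix_mul_assoc[symmetric] rexp_comm)
    qed
    then have "\<gamma> t ** (rexp X (- t) ** rexp X t) = \<gamma> 0 ** rexp X t"
      by (simp add: matrix_mul_assoc)
    then show ?thesis by (simp add: rexp_minus')
  qed
  then show ?thesis by blast
qed

lemma rexp_invertible: "invertible (rexp X t)"
  using rexp_minus rexp_minus' unfolding invertible_def by blast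

lemma exp_geodesic_gl:
  fixes K X :: "real^'n^'n"
  assumes K: "invertible K"
  shows "geodesic_on gl_metric GL {0..1} (restrict (\<lambda>t. K ** rexp X t) {0..1})"
proof -
  let ?I = "{0..1::real}" and ?\<gamma> = "restrict (\<lambda>t. K ** rexp X t) {0..1}"
  \<comment> \<open>\<open>geodesic_on\<close> asks for \<open>D 0 = \<gamma>\<close> as functions,
    so \<open>D 0\<close> has to be the restriction; on \<open>{0..1}\<close> it agrees with the
    general formula.\<close>
  define D where "D = (\<lambda>k t. if k = 0 then ?\<gamma> t else K ** rexp X t ** mpow X k)"
  have D: "D k t = K ** rexp X t ** mpow X k" if "t \<in> ?I" for k t
    using that by (simp add: D_def)
  have inv: "invertible (K ** rexp X t)" for t
    using invertible_mult[OF K rexp_invertible] .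
  have "(D k has_vector_derivative D (Suc k) t) (at t within ?I)" if t: "t \<in> ?I" for k t
  proof (rule has_vector_derivative_transform[OF t])
    show "D k s = K ** rexp X s ** mpow X k" if "s \<in> ?I" for s using D[OF that] .
    have "((\<lambda>s. K ** rexp X s ** mpow X k) has_vector_derivative K ** (rexp X t ** X) ** mpow X k)
        (at t within ?I)"
      by (rule bounded_linear.has_vector_derivative[OF matmul.bounded_linear_left]
          bounded_linear.has_vector_derivative[OF matmul.bounded_linear_right]
          has_vector_derivative_at_within[OF rexp_has_vector_derivative])+
    moreover have "K ** (rexp X t ** X) ** mpow X k = D (Suc k) t"
      unfolding D[OF t] by (simp add: matrix_mul_assoc[symmetric] mpow_comm)
    ultimately show "((\<lambda>s. K ** rexp X s ** mpow X k) has_vector_derivative D (Suc k) t) (at t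
        within ?I)"
      by simp
  qed
  moreover have "D 2 t + christoffel gl_metric (?\<gamma> t) (D 1 t) (D 1 t) = 0" if t: "t \<in> ?I" for t
  proof -
    let ?g = "K ** rexp X t"
    have "?g ** X ** matrix_inv ?g ** (?g ** X) = ?g ** X ** (matrix_inv ?g ** ?g) ** X"
      by (simp only: matrix_mul_assoc)
    then show ?thesis
      unfolding D[OF t] using t christoffel_gl_metric[OF inv[of t], of "?g ** X"]
      by (simp add: numeral_2_eq_2 matrix_inv_inverse[OF inv[of t]] matrix_mul_assoc[of "K ** rexp X
          t" X X])
  qed
  moreover have "D 0 = ?\<gamma>" by (simp add: D_def fun_eq_iff)
  moreover have "?\<gamma> ` ?I \<subseteq> GL" using inv by (auto simp: GL_def)
  ultimately show ?thesis unfolding geodesic_on_def by (intro conjI exI[of _ D] allI ballI)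
qed

lemma rexp_eq_on_imp_eq:
  assumes "\<And>t. t \<in> {0..1} \<Longrightarrow> rexp X t = rexp Y t"
  shows "X = (Y :: real^'n^'n)"
proof -
  \<comment> \<open>An interior point, where agreement on \<open>{0..1}\<close> determines the
    two-sided derivative.\<close>
  let ?h = "1/2 :: real"
  have "(rexp X has_vector_derivative rexp Y ?h ** Y) (at ?h)"
    by (rule has_vector_derivative_transform_within_open[OF rexp_has_vector_derivative
        open_greaterThanLessThan[of 0 1]])
      (use assms in auto)
  then have "rexp X ?h ** X = rexp Y ?h ** Y"
    using vector_derivative_unique_at[OF rexp_has_vector_derivative] by blast
  also have "rexp Y ?h = rexp X ?h" using assms[of ?h] by simp
  finally have "rexp X (- ?h) ** rexp X ?h ** X = rexp X (- ?h) ** rexp X ?h ** Y"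
    by (simp add: matrix_mul_assoc[symmetric])
  then show ?thesis by (simp add: rexp_minus')
qed

lemma geodesic_arcs_bij:
  fixes K0 K1 :: "real^'n^'n"
  assumes "K0 \<in> GL"
  shows "bij_betw (\<lambda>X. restrict (\<lambda>t. K0 ** rexp X t) {0..1})
    {X. rexp X 1 = matrix_inv K0 ** K1} (geodesic_arcs K0 K1)"
proof (rule bij_betwI')
  have K0: "invertible K0" using assms by (simp add: GL_def)
  note inv = matrix_inv_inverse[OF K0]
  have cancel: "K0 ** A = K0 ** B \<longleftrightarrow> A = B" for A B :: "real^'n^'n"
  proof
    assume "K0 ** A = K0 ** B"
    then have "matrix_inv K0 ** (K0 ** A) = matrix_inv K0 ** (K0 ** B)" by simp
    then show "A = B" by (simp add: matrix_mul_assoc inv)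
  qed simp
  show "(restrict (\<lambda>t. K0 ** rexp X t) {0..1} = restrict (\<lambda>t. K0 ** rexp Y t) {0..1}) \<longleftrightarrow> X = Y"
    for X Y :: "real^'n^'n"
  proof
    assume eq: "restrict (\<lambda>t. K0 ** rexp X t) {0..1} = restrict (\<lambda>t. K0 ** rexp Y t) {0..1}"
    have "rexp X t = rexp Y t" if "t \<in> {0..1}" for t
      using fun_cong[OF eq, of t] that cancel by (simp add: restrict_def)
    then show "X = Y" by (rule rexp_eq_on_imp_eq)
  qed simp
  show "restrict (\<lambda>t. K0 ** rexp X t) {0..1} \<in> geodesic_arcs K0 K1"
    if "X \<in> {X. rexp X 1 = matrix_inv K0 ** K1}" for X
    using that exp_geodesic_gl[OF K0] inv by (simp add: geodesic_arcs_def matrix_mul_assoc)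
  show "\<exists>X\<in>{X. rexp X 1 = matrix_inv K0 ** K1}. \<gamma> = restrict (\<lambda>t. K0 ** rexp X t) {0..1}"
    if \<gamma>: "\<gamma> \<in> geodesic_arcs K0 K1" for \<gamma>
  proof -
    have g: "geodesic_on gl_metric GL {0..1} \<gamma>" "\<gamma> 0 = K0" "\<gamma> 1 = K1" "\<gamma> \<in> extensional {0..1}"
      using \<gamma> by (auto simp: geodesic_arcs_def)
    obtain X where "\<forall>t\<in>{0..1}. \<gamma> t = \<gamma> 0 ** rexp X t"
      using geodesic_gl_eq_exp[OF g(1)] by (rule exE)
    then have X: "\<gamma> t = K0 ** rexp X t" if "t \<in> {0..1}" for t
      using that g(2) by simp
    have "matrix_inv K0 ** K1 = rexp X 1"
      using X[of 1] g(3) inv(2) by (simp add: matrix_mul_assoc)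
    moreover have "\<gamma> = restrict (\<lambda>t. K0 ** rexp X t) {0..1}"
      using X g(4) by (auto simp: fun_eq_iff restrict_def extensional_def)
    ultimately show ?thesis by auto
  qed
qed

section \<open>Real logarithms\<close>

abbreviation cnj_block :: "nat \<times> complex \<Rightarrow> nat \<times> complex" where
  "cnj_block \<equiv> map_prod id cnj"

abbreviation blocks :: "real^'n^'n \<Rightarrow> (nat \<times> complex) multiset" where
  "blocks A \<equiv> jordan_blocks (complex_mat A)"

lemma blocks_jordan_nf:
  obtains bs where "jordan_nf (complex_mat A) bs" "blocks A = mset bs"
proof -
  obtain bs where "jordan_nf (complex_mat A) bs" using jordan_nf_complex_exists[OF
      complex_mat_carrier] by blast
  then show thesis using that jordan_blocks_eq by blast
qed

lemma eigenvalue_iff_blocks: "eigenvalue (complex_mat A) z \<longleftrightarrow> z \<in> snd ` set_mset (blocks A)"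
  by (rule blocks_jordan_nf[of A]) (simp add: eigenvalue_iff_jordan_nf[OF complex_mat_carrier])

lemma cnj_blocks: "image_mset cnj_block (blocks A) = blocks A"
proof (rule blocks_jordan_nf[of A])
  fix bs assume bs: "jordan_nf (complex_mat A) bs" "blocks A = mset bs"
  have "jordan_nf (complex_mat A) (map cnj_block bs)" using jordan_nf_cnj[OF bs(1)] by simp
  from jordan_blocks_eq[OF this] bs(2) show ?thesis by simp
qed

lemma cnj_block_in_blocks: "b \<in># blocks A \<Longrightarrow> cnj_block b \<in># blocks A"
  using cnj_blocks[of A] by (metis image_eqI set_image_mset)

lemma blocks_rexp: "blocks (rexp X 1) = image_mset exp_block (blocks X)"
proof (rule blocks_jordan_nf[of X])
  fix bs assume bs: "jordan_nf (complex_mat X) bs" "blocks X = mset bs"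
  obtain E where E: "has_mexp (complex_mat X) 1 E" "jordan_nf E (map exp_block bs)"
    using jordan_nf_has_mexp[OF bs(1)] by blast
  have "E = complex_mat (rexp X 1)"
    using has_mexp_unique[OF E(1)] has_mexp_complex_mat[of X 1] by simp
  then show ?thesis using jordan_blocks_eq[OF E(2)] bs(2) by simp
qed

lemma rexp_exists_blocks:
  fixes A :: "real^'n^'n"
  assumes "blocks A = image_mset exp_block (P + image_mset cnj_block P + R)"
    and "\<And>b. b \<in># R \<Longrightarrow> snd b \<in> \<real>"
  obtains X where "rexp X 1 = A" "blocks X = P + image_mset cnj_block P + R"
proof -
  obtain ps where ps: "mset ps = P" using ex_mset[of P] by blast
  obtain rs where rs: "mset rs = R" using ex_mset[of R] by blast
  obtain bs where bs: "jordan_nf (complex_mat A) bs" "blocks A = mset bs" by (rule blocks_jordan_nf)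
  have m: "mset bs = mset (map exp_block (ps @ map cnj_block ps @ rs))"
    unfolding bs(2)[symmetric] assms(1) ps[symmetric] rs[symmetric]
    by (simp add: multiset.map_comp)
  have r: "snd b \<in> \<real>" if "b \<in> set rs" for b
    using that unfolding set_mset_mset[symmetric] rs by (rule assms(2))
  obtain Y where Y: "Y \<in> carrier_mat CARD('n) CARD('n)" "mat_cnj Y = Y"
    "has_mexp Y 1 (complex_mat A)" "jordan_nf Y (ps @ map cnj_block ps @ rs)"
  proof (rule real_log_exists[OF complex_mat_carrier mat_cnj_complex_mat bs(1) m r])
    fix Y assume "Y \<in> carrier_mat CARD('n) CARD('n)" "mat_cnj Y = Y"
      "has_mexp Y 1 (complex_mat A)" "jordan_nf Y (ps @ map cnj_block ps @ rs)"
    then show thesis by (rule that)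
  qed
  obtain X :: "real^'n^'n" where X: "complex_mat X = Y" by (rule complex_mat_surj[OF Y(1,2)])
  have "rexp X 1 = A" using Y(3) X by (simp add: rexp_eq_iff)
  moreover have "blocks X = P + image_mset cnj_block P + R"
    using jordan_blocks_eq[OF Y(4)] X by (simp add: ps rs add.assoc)
  ultimately show thesis by (rule that)
qed

section \<open>Cardinality and uniqueness of logarithms\<close>

text \<open>A point of a T1 space is determined by the basic open sets around it, so a countable
  basis embeds the space into the sets of natural numbers. This bounds every set of matrices from
  above.\<close>

lemma lepoll_reals: "(UNIV :: 'a::{second_countable_topology,t1_space} set) \<lesssim> (UNIV :: real set)"
proof -
  obtain B :: "'a set set" where B: "countable B" "topological_basis B"
    using ex_countable_basis by blast
  have "inj (\<lambda>x. to_nat_on B ` {b \<in> B. x \<in> b})"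
  proof (rule injI)
    fix x y :: 'a assume "to_nat_on B ` {b \<in> B. x \<in> b} = to_nat_on B ` {b \<in> B. y \<in> b}"
    then have eq: "{b \<in> B. x \<in> b} = {b \<in> B. y \<in> b}"
      by (subst (asm) inj_on_image_eq_iff[OF inj_on_to_nat_on[OF B(1)]]) auto
    show "x = y"
    proof (rule ccontr)
      assume "x \<noteq> y"
      then obtain U where "open U" "x \<in> U" "y \<notin> U" using t1_space by blast
      then obtain b where "b \<in> B" "x \<in> b" "b \<subseteq> U"
        by (auto elim: topological_basisE[OF B(2)])
      then show False using eq \<open>y \<notin> U\<close> by blast
    qed
  qed
  then have "(UNIV :: 'a set) \<lesssim> (UNIV :: nat set set)" unfolding lepoll_def by blast
  then show ?thesis using nat_sets_eqpoll_reals lepoll_trans2 by blast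
qed

lemma logarithms_continuum:
  fixes X :: "real^'n^'n"
  assumes ev: "eigenvalue (complex_mat X) \<mu>" "eigenvalue (complex_mat X) \<nu>" "\<mu> \<noteq> \<nu>" "exp \<mu> = exp \<nu>"
  shows "{Y. rexp Y 1 = rexp X 1} \<approx> (UNIV :: real set)"
proof (rule lepoll_antisym)
  have "has_mexp (complex_mat X) 1 (complex_mat (rexp X 1))" using has_mexp_complex_mat[of X 1] by simp
  from commuting_exp_not_commuting[OF complex_mat_carrier mat_cnj_complex_mat this ev]
  obtain M where M: "M \<in> carrier_mat CARD('n) CARD('n)" "mat_cnj M = M"
    "complex_mat (rexp X 1) * M = M * complex_mat (rexp X 1)" "complex_mat X * M \<noteq> M * complex_mat X"
    by blast
  obtain C :: "real^'n^'n" where C: "complex_mat C = M" by (rule complex_mat_surj[OF M(1,2)])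
  have AC: "rexp X 1 ** C = C ** rexp X 1" and XC: "X ** C \<noteq> C ** X"
    using M(3,4) by (simp_all only: C[symmetric] complex_mat_mult[symmetric] complex_mat_inj
        not_False_eq_True)
  \<comment> \<open>\<open>C\<close> need not be invertible; \<open>1 + t C\<close> is for small
    \<open>t\<close>, and it commutes with the exponential as well. Only positive \<open>t\<close>
    are taken, since \<open>s\<close> is divided out at the end.\<close>
  let ?W = "\<lambda>t::real. mat_one + t *\<^sub>R C"
  have "((\<lambda>t. ?W t) \<longlongrightarrow> mat_one) (at 0)" by (intro tendsto_eq_intros) auto
  moreover have "\<forall>\<^sub>F q in nhds mat_one. invertible (q :: real^'n^'n)"
    by (rule eventually_invertible) (auto simp: invertible_def intro: exI[of _ mat_one])
  ultimately have "\<forall>\<^sub>F t in at 0. invertible (?W t)" unfolding filterlim_iff by blast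
  then obtain e where e: "e > 0" "\<And>t. t \<noteq> 0 \<Longrightarrow> dist t 0 < e \<Longrightarrow> invertible (?W t)"
    unfolding eventually_at by blast
  have inv: "?W t ** matrix_inv (?W t) = mat_one" "matrix_inv (?W t) ** ?W t = mat_one"
      if "t \<in> {0<..<e}" for t
    using matrix_inv_inverse e(2)[of t] that by auto
  let ?g = "\<lambda>t. ?W t ** X ** matrix_inv (?W t)"
  have "?g ` {0<..<e} \<subseteq> {Y. rexp Y 1 = rexp X 1}"
  proof safe
    fix t assume t: "t \<in> {0<..<e}"
    have "?W t ** rexp X 1 = rexp X 1 ** ?W t"
      using AC by (simp add: matmul.add_left matmul.add_right matmul.scaleR_left matmul.scaleR_right)
    then have "rexp (?g t) 1 = rexp X 1 ** (?W t ** matrix_inv (?W t))"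
      using rexp_similar[OF inv[OF t], of X 1] by (simp add: matrix_mul_assoc)
    then show "rexp (?g t) 1 = rexp X 1" using inv[OF t] by simp
  qed
  moreover have "inj_on ?g {0<..<e}"
  proof (rule inj_onI)
    fix s t assume s: "s \<in> {0<..<e}" and t: "t \<in> {0<..<e}" and eq: "?g s = ?g t"
    \<comment> \<open>Two of the conjugates of \<open>X\<close> agree exactly if this quotient
      commutes with \<open>X\<close>.\<close>
    let ?Z = "matrix_inv (?W s) ** ?W t"
    have "X ** ?Z = matrix_inv (?W s) ** ?g s ** ?W t"
    proof -
      have "matrix_inv (?W s) ** ?g s ** ?W t = (matrix_inv (?W s) ** ?W s) ** X ** matrix_inv (?W
          s) ** ?W t"
        by (simp only: matrix_mul_assoc)
      then show ?thesis using inv[OF s] by (simp add: matrix_mul_assoc)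
    qed
    also have "\<dots> = ?Z ** X ** (matrix_inv (?W t) ** ?W t)"
      unfolding eq by (simp only: matrix_mul_assoc)
    finally have XZ: "X ** ?Z = ?Z ** X" using inv[OF t] by simp
    show "s = t"
    proof (rule ccontr)
      assume "s \<noteq> t"
      \<comment> \<open>\<open>(1 + s C) Z = 1 + t C\<close> gives \<open>C (t - s Z) = Z - 1\<close>, where \<open>t - s Z = (t - s) (1 + s C)\<inverse>\<close>
        and \<open>Z - 1 = (t - s) C (1 + s C)\<inverse>\<close>. So \<open>X\<close> commutes with \<open>(1 + s C)\<inverse>\<close>, hence with \<open>C\<close>.\<close>
      have "t *\<^sub>R mat_one - s *\<^sub>R ?Z = matrix_inv (?W s) ** (t *\<^sub>R ?W s - s *\<^sub>R ?W t)"
        using inv[OF s] by (simp add: matmul.diff_right matmul.scaleR_right)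
      also have "t *\<^sub>R ?W s - s *\<^sub>R ?W t = (t - s) *\<^sub>R mat_one"
        by (simp add: algebra_simps)
      finally have Wi: "t *\<^sub>R mat_one - s *\<^sub>R ?Z = (t - s) *\<^sub>R matrix_inv (?W s)"
        by (simp add: matmul.scaleR_right)
      have "X ** (t *\<^sub>R mat_one - s *\<^sub>R ?Z) = (t *\<^sub>R mat_one - s *\<^sub>R ?Z) ** X"
        using XZ by (simp add: matmul.diff_right matmul.diff_left matmul.scaleR_right
            matmul.scaleR_left)
      then have "X ** matrix_inv (?W s) = matrix_inv (?W s) ** X"
        unfolding Wi using \<open>s \<noteq> t\<close> by (simp add: matmul.scaleR_right matmul.scaleR_left)
      then have "?W s ** (X ** matrix_inv (?W s)) ** ?W s =
          ?W s ** (matrix_inv (?W s) ** X) ** ?W s" by simp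
      moreover have "?W s ** (X ** matrix_inv (?W s)) ** ?W s =
          ?W s ** X ** (matrix_inv (?W s) ** ?W s)"
        "?W s ** (matrix_inv (?W s) ** X) ** ?W s = (?W s ** matrix_inv (?W s)) ** X ** ?W s"
        by (simp_all only: matrix_mul_assoc)
      ultimately have "?W s ** X = X ** ?W s" using inv[OF s] by simp
      then have "s *\<^sub>R (C ** X) = s *\<^sub>R (X ** C)"
        by (simp add: matmul.add_left matmul.add_right matmul.scaleR_left matmul.scaleR_right)
      then show False using XC s by simp
    qed
  qed
  ultimately have "{0<..<e} \<lesssim> {Y. rexp Y 1 = rexp X 1}" unfolding lepoll_def by blast
  then show "(UNIV :: real set) \<lesssim> {Y. rexp Y 1 = rexp X 1}"
    using open_interval_eqpoll_reals[of 0 e] e(1) lepoll_trans1 eqpoll_sym by blast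
  show "{Y. rexp Y 1 = rexp X 1} \<lesssim> (UNIV :: real set)"
    using lepoll_trans[OF subset_imp_lepoll[OF subset_UNIV] lepoll_reals] .
qed

text \<open>\<open>F\<close> has to contain both spectra: the difference of the two exponentials has
  exponents from both, and injectivity of \<open>exp\<close> on each one alone would allow different
  logarithms of the same eigenvalue.\<close>

lemma logarithm_unique:
  fixes X Y :: "real^'n^'n"
  assumes eq: "rexp X 1 = rexp Y 1" and F: "finite F" "inj_on exp F"
    and "\<And>z. eigenvalue (complex_mat X) z \<Longrightarrow> z \<in> F" "\<And>z. eigenvalue (complex_mat Y) z \<Longrightarrow> z \<in> F"
  shows "X = Y"
proof -
  obtain E where E: "\<And>t. has_mexp (complex_mat X) t (E t)"
    "\<And>i j. i < CARD('n) \<Longrightarrow> j < CARD('n) \<Longrightarrow> exppoly F (\<lambda>t. E t $$ (i, j))"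
  proof (rule has_mexp_exppoly[OF complex_mat_carrier F(1) assms(4)])
    fix E assume "\<And>t. has_mexp (complex_mat X) t (E t)"
      "\<And>i j. i < CARD('n) \<Longrightarrow> j < CARD('n) \<Longrightarrow> exppoly F (\<lambda>t. E t $$ (i, j))"
    then show thesis by (rule that)
  qed
  obtain G where G: "\<And>t. has_mexp (complex_mat Y) t (G t)"
    "\<And>i j. i < CARD('n) \<Longrightarrow> j < CARD('n) \<Longrightarrow> exppoly F (\<lambda>t. G t $$ (i, j))"
  proof (rule has_mexp_exppoly[OF complex_mat_carrier F(1) assms(5)])
    fix E assume "\<And>t. has_mexp (complex_mat Y) t (E t)"
      "\<And>i j. i < CARD('n) \<Longrightarrow> j < CARD('n) \<Longrightarrow> exppoly F (\<lambda>t. E t $$ (i, j))"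
    then show thesis by (rule that)
  qed
  have E': "E (of_real t) = complex_mat (rexp X t)" for t
    by (rule has_mexp_unique[OF E(1) has_mexp_complex_mat])
  have G': "G (of_real t) = complex_mat (rexp Y t)" for t
    by (rule has_mexp_unique[OF G(1) has_mexp_complex_mat])
  have nat: "E (of_nat m) = G (of_nat m)" for m
    using E'[of "of_nat m"] G'[of "of_nat m"] eq by (simp add: rexp_of_nat)
  have "rexp X t = rexp Y t" for t
  proof -
    have "complex_mat (rexp X t) = complex_mat (rexp Y t)"
    proof (rule eq_matI)
      fix i j assume "i < dim_row (complex_mat (rexp Y t))" "j < dim_col (complex_mat (rexp Y t))"
      then have ij: "i < CARD('n)" "j < CARD('n)" by simp_all
      have "exppoly F (\<lambda>t. E t $$ (i, j) + (-1) * G t $$ (i, j))"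
        by (intro exppoly_add exppoly_cmult E(2) G(2) ij)
      from exppoly_eq_zero[OF this F] have "E (of_real t) $$ (i, j) +
          (-1) * G (of_real t) $$ (i, j) = 0"
        using nat by simp
      then show "complex_mat (rexp X t) $$ (i, j) = complex_mat (rexp Y t) $$ (i, j)"
        unfolding E' G' by simp
    qed simp_all
    then show ?thesis by (simp only: complex_mat_inj)
  qed
  then show ?thesis by (rule rexp_eq_on_imp_eq)
qed

section \<open>Jordan blocks of real logarithms\<close>

abbreviation Ln_block :: "nat \<times> complex \<Rightarrow> nat \<times> complex" where
  "Ln_block \<equiv> map_prod id Ln"

lemma exp_block_Ln_block: "snd b \<noteq> 0 \<Longrightarrow> exp_block (Ln_block b) = b"
  by (cases b) simp

lemma image_exp_Ln_block:
  assumes "\<And>b. b \<in># P \<Longrightarrow> snd b \<noteq> 0"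
  shows "image_mset exp_block (image_mset Ln_block P) = P"
proof -
  have "image_mset exp_block (image_mset Ln_block P) = image_mset (\<lambda>b. b) P"
    unfolding multiset.map_comp using assms by (intro image_mset_cong) (simp add: exp_block_Ln_block)
  then show ?thesis by simp
qed

lemma exp_block_cnj_block: "exp_block (cnj_block b) = cnj_block (exp_block b)"
  by (cases b) (simp add: exp_cnj)

lemma exp_plus_2pi_i: "exp (z + 2 * of_int m * of_real pi * \<i>) = exp z"
  using exp_eq[of "z + 2 * of_int m * of_real pi * \<i>" z] by (auto intro!: exI[of _ m])

text \<open>The blocks are split into a half \<open>P\<close> of the pairs of conjugate blocks, whose logarithms can be chosen
  freely, and a rest \<open>R\<close> which gets the principal logarithm. Pairs of equal real blocks can be put into
  \<open>P\<close>.\<close>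

lemma rexp_exists_split:
  fixes A :: "real^'n^'n"
  assumes A: "blocks A = P + image_mset cnj_block P + R"
    and R: "\<And>b. b \<in># R \<Longrightarrow> snd b \<in> \<real> \<and> 0 < Re (snd b)"
    and P': "image_mset exp_block P' = P"
  obtains X where "rexp X 1 = A" "P' \<subseteq># blocks X"
proof -
  let ?R' = "image_mset Ln_block R"
  have R': "image_mset exp_block ?R' = R"
    by (rule image_exp_Ln_block) (use R in force)
  have "image_mset exp_block (image_mset cnj_block P') = image_mset cnj_block P"
    unfolding P'[symmetric] multiset.map_comp o_def exp_block_cnj_block ..
  then have B: "blocks A = image_mset exp_block (P' + image_mset cnj_block P' + ?R')"
    unfolding A image_mset_union P' R' by simp
  have real: "snd b \<in> \<real>" if "b \<in># ?R'" for b
  proof -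
    obtain c where c: "c \<in># R" "b = Ln_block c" using \<open>b \<in># ?R'\<close> by auto
    have "snd c = complex_of_real (Re (snd c))" using R[OF c(1)] by (simp add:
        complex_is_Real_iff complex_eq_iff)
    then have "Ln (snd c) = complex_of_real (ln (Re (snd c)))" using R[OF c(1)] by (metis Ln_of_real)
    then show ?thesis using c(2) by simp
  qed
  show thesis
  proof (rule rexp_exists_blocks[OF B real])
    fix X assume X: "rexp X 1 = A" "blocks X = P' + image_mset cnj_block P' + ?R'"
    have "P' \<subseteq># blocks X" unfolding X(2) add.assoc by simp
    with X(1) show thesis by (rule that)
  qed
qed

lemma filter_blocks_cnj:
  "filter_mset (\<lambda>b. Q (snd b)) (blocks A) = image_mset cnj_block (filter_mset (\<lambda>b. Q (cnj (snd b)))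
      (blocks A))"
proof -
  have "filter_mset (\<lambda>b. Q (snd b)) (image_mset cnj_block (blocks A)) =
      image_mset cnj_block (filter_mset (\<lambda>b. Q (cnj (snd b))) (blocks A))"
    by (simp add: filter_mset_image_mset)
  then show ?thesis by (simp add: cnj_blocks)
qed

lemma even_multiset_half:
  fixes N :: "'a multiset"
  assumes "\<And>b. even (count N b)"
  obtains H where "N = H + H"
proof -
  define H where "H = Abs_multiset (\<lambda>b. count N b div 2)"
  have "finite {b. 0 < count N b div 2}"
    by (rule finite_subset[OF _ finite_set_mset[of N]]) (auto intro: count_inI)
  then have "count H b = count N b div 2" for b
    unfolding H_def by (subst Abs_multiset_inverse) auto
  then have "N = H + H" using assms by (intro multiset_eqI) (simp add: flip: mult_2)
  then show thesis by (rule that)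
qed

text \<open>\<open>P\<close> consists of the blocks in the upper half-plane and one half of the
  negative blocks. The latter are fixed by conjugation, so the conjugate of \<open>P\<close>
  supplies the lower half-plane and the other half. The last conclusion leaves the logarithms of all
  upper blocks free to choose.\<close>

lemma blocks_split:
  fixes A :: "real^'n^'n"
  assumes nz: "\<And>b. b \<in># blocks A \<Longrightarrow> snd b \<noteq> 0"
    and even: "\<And>k x. x < 0 \<Longrightarrow> even (count (blocks A) (k, complex_of_real x))"
  obtains P R where "blocks A = P + image_mset cnj_block P + R"
    "R = filter_mset (\<lambda>b. snd b \<in> \<real> \<and> 0 < Re (snd b)) (blocks A)"
    "filter_mset (\<lambda>b. 0 < Im (snd b)) (blocks A) \<subseteq># P"
proof -
  let ?N = "filter_mset (\<lambda>b. snd b \<in> \<real> \<and> Re (snd b) < 0) (blocks A)"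
  let ?U = "filter_mset (\<lambda>b. 0 < Im (snd b)) (blocks A)"
  let ?R = "filter_mset (\<lambda>b. snd b \<in> \<real> \<and> 0 < Re (snd b)) (blocks A)"
  have ev: "even (count ?N b)" for b :: "nat \<times> complex"
  proof (cases "snd b \<in> \<real> \<and> Re (snd b) < 0")
    case True
    then have "b = (fst b, complex_of_real (Re (snd b)))"
      by (simp add: complex_is_Real_iff complex_eq_iff prod_eq_iff)
    then have "even (count (blocks A) b)" using even[of "Re (snd b)" "fst b"] True by simp
    then show ?thesis using True by simp
  next
    case False
    then show ?thesis by auto
  qed
  obtain H where H: "?N = H + H" using even_multiset_half[OF ev] by blast
  have cH: "image_mset cnj_block H = H"
  proof -
    have "cnj_block b = b" if "b \<in># H" for b
    proof -
      have "b \<in># ?N" using that unfolding H by simp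
      then have "cnj (snd b) = snd b" by (simp add: Reals_cnj_iff)
      then show ?thesis by (cases b) simp
    qed
    then have "image_mset cnj_block H = image_mset (\<lambda>b. b) H" by (intro image_mset_cong)
    then show ?thesis by simp
  qed
  have cU: "image_mset cnj_block ?U = filter_mset (\<lambda>b. Im (snd b) < 0) (blocks A)"
    using filter_blocks_cnj[of "\<lambda>z. Im z < 0" A] by simp
  have "blocks A = ?U + image_mset cnj_block ?U + ?N + ?R"
    unfolding cU
  proof (rule multiset_eqI)
    fix b :: "nat \<times> complex"
    have "b \<in># blocks A \<Longrightarrow> snd b \<in> \<real> \<Longrightarrow> Re (snd b) \<noteq> 0"
      using nz[of b] by (auto simp: complex_is_Real_iff complex_eq_iff)
    then show "count (blocks A) b = count (?U + filter_mset (\<lambda>b. Im (snd b) < 0) (blocks A) + ?N +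
        ?R) b"
      by (cases "b \<in># blocks A") (auto simp: complex_is_Real_iff not_in_iff)
  qed
  then have "blocks A = (?U + H) + image_mset cnj_block (?U + H) + ?R"
    unfolding H by (simp add: cH ac_simps)
  moreover have "?U \<subseteq># ?U + H" by simp
  ultimately show thesis using that[of "?U + H" ?R] by blast
qed

lemma exp_eigenvalue_rexp:
  assumes "eigenvalue (complex_mat X) \<mu>"
  shows "eigenvalue (complex_mat (rexp X 1)) (exp \<mu>)"
  using assms unfolding eigenvalue_iff_blocks blocks_rexp by force

lemma eigenvalue_rexp:
  assumes "eigenvalue (complex_mat (rexp X 1)) z"
  obtains \<mu> where "eigenvalue (complex_mat X) \<mu>" "exp \<mu> = z"
  using assms unfolding eigenvalue_iff_blocks blocks_rexp by force

lemma eigenvalue_cnj: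
  assumes "eigenvalue (complex_mat X) \<mu>"
  shows "eigenvalue (complex_mat X) (cnj \<mu>)"
  using assms cnj_block_in_blocks[of _ X] unfolding eigenvalue_iff_blocks by force

lemma count_image_mset_size: "count (image_mset f N) y = size (filter_mset (\<lambda>b. f b = y) N)"
  by (induction N) auto

text \<open>No logarithm of \<open>x\<close> is real, so conjugation pairs the blocks of
  \<open>X\<close> above \<open>x\<close> without leaving any block fixed. It keeps sizes, hence
  those with positive and those with negative imaginary part are equally many.\<close>

lemma even_count_negative:
  assumes "x < 0"
  shows "even (count (blocks (rexp X 1)) (k, complex_of_real x))"
proof -
  let ?Q = "\<lambda>z. exp z = complex_of_real x"
  let ?up = "filter_mset (\<lambda>b. fst b = k \<and> ?Q (snd b) \<and> 0 < Im (snd b)) (blocks X)"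
  let ?lo = "filter_mset (\<lambda>b. fst b = k \<and> ?Q (snd b) \<and> Im (snd b) < 0) (blocks X)"
  have Q: "?Q (cnj z) \<longleftrightarrow> ?Q z" for z
    by (metis complex_cnj_cnj complex_cnj_complex_of_real exp_cnj)
  have "?lo = filter_mset (\<lambda>b. fst b = k \<and> ?Q (snd b) \<and> Im (snd b) < 0) (image_mset cnj_block
      (blocks X))"
    by (simp add: cnj_blocks)
  also have "\<dots> = image_mset cnj_block ?up"
    by (simp add: filter_mset_image_mset Q)
  finally have size: "size ?lo = size ?up" by simp
  have "count (blocks (rexp X 1)) (k, complex_of_real x) =
      size (filter_mset (\<lambda>b. fst b = k \<and> ?Q (snd b)) (blocks X))"
    unfolding blocks_rexp count_image_mset_size by (simp add: prod_eq_iff)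
  also have "filter_mset (\<lambda>b. fst b = k \<and> ?Q (snd b)) (blocks X) = ?up + ?lo"
  proof (rule multiset_eqI)
    fix b :: "nat \<times> complex"
    have "Im (snd b) \<noteq> 0" if "?Q (snd b)"
    proof
      assume "Im (snd b) = 0"
      then have "snd b = complex_of_real (Re (snd b))" by (simp add: complex_eq_iff)
      then have "complex_of_real (exp (Re (snd b))) = complex_of_real x"
          using that by (metis exp_of_real)
      then show False using assms by (metis exp_gt_zero not_less_iff_gr_or_eq of_real_eq_iff)
    qed
    then show "count (filter_mset (\<lambda>b. fst b = k \<and> ?Q (snd b)) (blocks X)) b = count (?up + ?lo) b"
      by auto
  qed
  finally show ?thesis using size by simp
qed

lemma two_preimages_count:
  assumes "b \<in># N" "c \<in># N" "b \<noteq> c" "f b = d" "f c = d"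
  shows "2 \<le> count (image_mset f N) d"
proof -
  obtain N1 where N1: "N = add_mset b N1" using multi_member_split[OF assms(1)] by blast
  then have "c \<in># N1" using assms(2,3) by simp
  then obtain N2 where "N1 = add_mset c N2" using multi_member_split[of c N1] by blast
  then show ?thesis using assms(4,5) by (simp add: N1)
qed

lemma two_preimages_size:
  assumes "b \<in># N" "c \<in># N" "b \<noteq> c" "Q (f b)" "Q (f c)"
  shows "2 \<le> size (filter_mset Q (image_mset f N))"
proof -
  obtain N1 where N1: "N = add_mset b N1" using multi_member_split[OF assms(1)] by blast
  then have "c \<in># N1" using assms(2,3) by simp
  then obtain N2 where "N1 = add_mset c N2" using multi_member_split[of c N1] by blast
  then show ?thesis using assms(4,5) by (simp add: N1)
qed

text \<open>A nonreal \<open>\<mu>\<close> would bring \<open>cnj \<mu>\<close> with a block of the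
  same size, and both would be sent to the same block of the exponential, against multiplicity
  1.\<close>

lemma real_log_eigenvalue:
  assumes z: "exp \<mu> \<in> \<real>" "0 < Re (exp \<mu>)" "\<And>k. count (blocks (rexp X 1)) (k, exp \<mu>) \<le> 1"
    and \<mu>: "eigenvalue (complex_mat X) \<mu>"
  shows "\<mu> = Ln (exp \<mu>)"
proof -
  obtain k where k: "(k, \<mu>) \<in># blocks X" using \<mu> unfolding eigenvalue_iff_blocks by auto
  have "cnj (exp \<mu>) = exp \<mu>" using z(1) by (simp add: Reals_cnj_iff)
  have "\<mu> \<in> \<real>"
  proof (rule ccontr)
    assume "\<mu> \<notin> \<real>"
    then have "cnj \<mu> \<noteq> \<mu>" by (simp add: Reals_cnj_iff)
    moreover have "(k, cnj \<mu>) \<in># blocks X" using cnj_block_in_blocks[OF k] by simp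
    ultimately have "2 \<le> count (blocks (rexp X 1)) (k, exp \<mu>)"
      unfolding blocks_rexp using k \<open>cnj (exp \<mu>) = exp \<mu>\<close>
      by (intro two_preimages_count[of "(k, \<mu>)" _ "(k, cnj \<mu>)"]) (auto simp: exp_cnj)
    then show False using z(3)[of k] by simp
  qed
  then have "Im \<mu> = 0" by (simp add: complex_is_Real_iff)
  then show ?thesis by (simp add: Ln_exp)
qed

text \<open>Two logarithms of a nonreal eigenvalue are not tied by conjugation and may have blocks
  of different sizes. This is why \<open>num_jordan_blocks\<close> is bounded there, but only the
  multiplicity of each size at a real eigenvalue.\<close>

lemma inj_on_exp_eigenvalues:
  fixes X :: "real^'n^'n"
  assumes pos: "\<And>x. eigenvalue (complex_mat (rexp X 1)) (complex_of_real x) \<Longrightarrow>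
      0 < x \<and> (\<forall>k. count (blocks (rexp X 1)) (k, complex_of_real x) \<le> 1)"
    and nonreal: "\<And>z. eigenvalue (complex_mat (rexp X 1)) z \<Longrightarrow> z \<notin> \<real> \<Longrightarrow>
      num_jordan_blocks (complex_mat (rexp X 1)) z \<le> 1"
  shows "inj_on exp {z. eigenvalue (complex_mat X) z}"
proof (rule inj_onI)
  fix \<mu> \<nu> assume "\<mu> \<in> {z. eigenvalue (complex_mat X) z}" "\<nu> \<in> {z. eigenvalue (complex_mat X) z}"
    and eq: "exp \<mu> = exp \<nu>"
  then have ev: "eigenvalue (complex_mat X) \<mu>" "eigenvalue (complex_mat X) \<nu>" by auto
  note ev' = exp_eigenvalue_rexp[OF ev(1)]
  show "\<mu> = \<nu>"
  proof (cases "exp \<mu> \<in> \<real>")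
    case True
    then obtain x where x: "exp \<mu> = complex_of_real x" by (auto simp: Reals_def)
    then have x': "0 < x" "\<And>k. count (blocks (rexp X 1)) (k, exp \<mu>) \<le> 1" using pos[of x] ev' by auto
    then have "0 < Re (exp \<mu>)" using x by simp
    from real_log_eigenvalue[OF True this x'(2) ev(1)]
      real_log_eigenvalue[OF True[unfolded eq] this[unfolded eq] x'(2)[unfolded eq] ev(2)]
    show ?thesis using eq by simp
  next
    case False
    show ?thesis
    proof (rule ccontr)
      assume "\<mu> \<noteq> \<nu>"
      obtain k l where kl: "(k, \<mu>) \<in># blocks X" "(l, \<nu>) \<in># blocks X"
        using ev unfolding eigenvalue_iff_blocks by auto
      have "2 \<le> num_jordan_blocks (complex_mat (rexp X 1)) (exp \<mu>)"
        unfolding num_jordan_blocks_def blocks_rexp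
        by (rule two_preimages_size[OF kl]) (use \<open>\<mu> \<noteq> \<nu>\<close> eq in auto)
      then show False using nonreal[OF ev' False] by simp
    qed
  qed
qed

section \<open>Counting the real logarithms\<close>

abbreviation logarithms :: "real^'n^'n \<Rightarrow> (real^'n^'n) set" where
  "logarithms A \<equiv> {X. rexp X 1 = A}"

lemma eigenvalue_complex_mat_nonzero:
  assumes A: "invertible (A :: real^'n^'n)" and z: "eigenvalue (complex_mat A) z"
  shows "z \<noteq> 0"
proof
  assume "z = 0"
  then obtain v where v: "v \<in> carrier_vec CARD('n)" "v \<noteq> 0\<^sub>v CARD('n)" "complex_mat A *\<^sub>v v = 0 \<cdot>\<^sub>v v"
    using z unfolding eigenvalue_def eigenvector_def by auto
  have "complex_mat (matrix_inv A) * complex_mat A = 1\<^sub>m CARD('n)"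
    unfolding complex_mat_mult[symmetric] matrix_inv_inverse(2)[OF A] by (rule complex_mat_one)
  then have "v = complex_mat (matrix_inv A) *\<^sub>v (complex_mat A *\<^sub>v v)"
    using assoc_mult_mat_vec[OF complex_mat_carrier complex_mat_carrier v(1), of "matrix_inv A"
        A] v(1) by simp
  also have "\<dots> = 0\<^sub>v CARD('n)"
    unfolding v(3) using v(1) by (intro eq_vecI) (auto simp: scalar_prod_def)
  finally show False using v(2) by simp
qed

lemma snd_blocks_nonzero: "invertible A \<Longrightarrow> b \<in># blocks A \<Longrightarrow> snd b \<noteq> 0"
  using eigenvalue_complex_mat_nonzero[of A "snd b"] unfolding eigenvalue_iff_blocks by force

lemma logarithms_nonempty_iff:
  fixes A :: "real^'n^'n"
  assumes A: "invertible A"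
  shows "logarithms A \<noteq> {} \<longleftrightarrow> (\<forall>k x. x < 0 \<longrightarrow> even (count (blocks A) (k, complex_of_real x)))"
proof
  assume "logarithms A \<noteq> {}"
  then show "\<forall>k x. x < 0 \<longrightarrow> even (count (blocks A) (k, complex_of_real x))"
    using even_count_negative by blast
next
  assume even: "\<forall>k x. x < 0 \<longrightarrow> even (count (blocks A) (k, complex_of_real x))"
  show "logarithms A \<noteq> {}"
  proof (rule blocks_split[of A])
    fix P R
    assume PR: "blocks A = P + image_mset cnj_block P + R"
      "R = filter_mset (\<lambda>b. snd b \<in> \<real> \<and> 0 < Re (snd b)) (blocks A)"
    have "image_mset exp_block (image_mset Ln_block P) = P"
      by (rule image_exp_Ln_block) (use snd_blocks_nonzero[OF A] PR(1) in auto)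
    then show ?thesis
      by (rule rexp_exists_split[OF PR(1), rotated]) (auto simp: PR(2))
  qed (use snd_blocks_nonzero[OF A] even in auto)
qed

lemma logarithm_split:
  fixes A :: "real^'n^'n"
  assumes A: "invertible A" "logarithms A \<noteq> {}"
  obtains P R where "blocks A = P + image_mset cnj_block P + R"
    "R = filter_mset (\<lambda>b. snd b \<in> \<real> \<and> 0 < Re (snd b)) (blocks A)"
    "filter_mset (\<lambda>b. 0 < Im (snd b)) (blocks A) \<subseteq># P"
    "\<And>b. b \<in># P \<Longrightarrow> snd b \<noteq> 0"
proof (rule blocks_split[of A])
  fix P R
  assume PR: "blocks A = P + image_mset cnj_block P + R"
    "R = filter_mset (\<lambda>b. snd b \<in> \<real> \<and> 0 < Re (snd b)) (blocks A)"
    "filter_mset (\<lambda>b. 0 < Im (snd b)) (blocks A) \<subseteq># P"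
  have "snd b \<noteq> 0" if "b \<in># P" for b
    using snd_blocks_nonzero[OF A(1), of b] that unfolding PR(1) by simp
  with PR show thesis by (rule that)
next
  show "even (count (blocks A) (k, complex_of_real x))" if "x < 0" for k x
    using A(2) even_count_negative[OF that] by blast
qed (rule snd_blocks_nonzero[OF A(1)])

section \<open>Eigenvalues that give a continuum of logarithms\<close>

text \<open>A logarithm of a negative number is not real, so it collides with its own
  conjugate.\<close>

lemma logarithms_continuum_negative:
  assumes "X \<in> logarithms A" and x: "x < 0" "eigenvalue (complex_mat A) (complex_of_real x)"
  shows "logarithms A \<approx> (UNIV :: real set)"
proof -
  have A: "A = rexp X 1" using assms(1) by simp
  obtain \<mu> where \<mu>: "eigenvalue (complex_mat X) \<mu>" "exp \<mu> = complex_of_real x"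
    using eigenvalue_rexp x(2) unfolding A by blast
  have "\<mu> \<noteq> cnj \<mu>"
  proof
    assume "\<mu> = cnj \<mu>"
    then have "\<mu> = complex_of_real (Re \<mu>)" by (simp add: complex_eq_iff)
    then have "complex_of_real (exp (Re \<mu>)) = complex_of_real x" using \<mu>(2) by (metis exp_of_real)
    then show False using x(1) by (metis exp_gt_zero not_less_iff_gr_or_eq of_real_eq_iff)
  qed
  moreover have "exp \<mu> = exp (cnj \<mu>)" unfolding exp_cnj[symmetric] \<mu>(2) by simp
  ultimately show ?thesis
    unfolding A using logarithms_continuum[OF \<mu>(1) eigenvalue_cnj[OF \<mu>(1)]] by blast
qed

lemma subseteq_mset_decompose:
  assumes "M \<subseteq># N"
  obtains K where "N = M + K"
  using assms by (metis subset_mset.add_diff_inverse)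

text \<open>\<open>logarithm_split\<close> puts both equal blocks into \<open>R\<close>, where they
  would get the same real logarithm. As a real block is its own conjugate, they can be moved out as
  a conjugate pair; one gets a nonreal logarithm and the other the conjugate of it.\<close>

lemma logarithms_continuum_positive:
  fixes A :: "real^'n^'n"
  assumes A: "invertible A" "logarithms A \<noteq> {}"
    and x: "0 < x" "1 < count (blocks A) (k, complex_of_real x)"
  shows "logarithms A \<approx> (UNIV :: real set)"
proof (rule logarithm_split[OF A])
  fix P R
  assume PR: "blocks A = P + image_mset cnj_block P + R"
    "R = filter_mset (\<lambda>b. snd b \<in> \<real> \<and> 0 < Re (snd b)) (blocks A)"
    "\<And>b. b \<in># P \<Longrightarrow> snd b \<noteq> 0"
  \<comment> \<open>The shift by \<open>2 pi \<i>\<close> makes the logarithm nonreal;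
    \<open>of_int 1\<close> matches the form of \<open>exp_plus_2pi_i\<close>.\<close>
  let ?b = "(k, complex_of_real x)" and ?\<mu> = "Ln (complex_of_real x) + 2 * of_int 1 * of_real pi * \<i>"
  have "{#?b, ?b#} \<subseteq># R"
    unfolding PR(2) subseteq_mset_def using x by auto
  then obtain R' where R': "R = {#?b, ?b#} + R'" by (rule subseteq_mset_decompose)
  have exp_mu: "exp ?\<mu> = complex_of_real x" using x(1) unfolding exp_plus_2pi_i by simp
  have "blocks A = add_mset ?b P + image_mset cnj_block (add_mset ?b P) + R'"
    unfolding PR(1) R' by simp
  moreover have "snd b \<in> \<real> \<and> 0 < Re (snd b)" if "b \<in># R'" for b
  proof -
    have "b \<in># R" using that R' by simp
    then show ?thesis unfolding PR(2) by simp
  qed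
  moreover have "image_mset exp_block (add_mset (k, ?\<mu>) (image_mset Ln_block P)) = add_mset ?b P"
    using image_exp_Ln_block[OF PR(3)] exp_mu by simp
  ultimately show ?thesis
  proof (rule rexp_exists_split)
    fix X assume X: "rexp X 1 = A" "add_mset (k, ?\<mu>) (image_mset Ln_block P) \<subseteq># blocks X"
    then have "(k, ?\<mu>) \<in># blocks X" by (meson mset_subset_eqD union_single_eq_member)
    then have ev: "eigenvalue (complex_mat X) ?\<mu>" unfolding eigenvalue_iff_blocks by force
    have "Im ?\<mu> \<noteq> 0" using x(1) by (simp add: Ln_of_real)
    then have "?\<mu> \<noteq> cnj ?\<mu>" by (metis complex_cnj_cancel_iff Reals_cnj_iff complex_is_Real_iff)
    moreover have "exp ?\<mu> = exp (cnj ?\<mu>)" unfolding exp_cnj[symmetric] exp_mu by simp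
    ultimately show ?thesis
      unfolding X(1)[symmetric] using logarithms_continuum[OF ev eigenvalue_cnj[OF ev]] by blast
  qed
qed

lemma num_jordan_blocks_cnj:
  "num_jordan_blocks (complex_mat A) (cnj z) = num_jordan_blocks (complex_mat A) z"
proof -
  have "cnj w = cnj z \<longleftrightarrow> w = z" for w by simp
  then show ?thesis
    unfolding num_jordan_blocks_def filter_blocks_cnj[of "\<lambda>w. w = cnj z" A] by simp
qed

text \<open>Two blocks for an eigenvalue \<open>w\<close> in the upper half-plane lie in
  \<open>P\<close>, where logarithms are chosen block by block; \<open>Ln w\<close> and its shift by
  \<open>2 pi \<i>\<close> collide.\<close>

lemma logarithms_continuum_nonreal:
  fixes A :: "real^'n^'n"
  assumes A: "invertible A" "logarithms A \<noteq> {}"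
    and z: "z \<notin> \<real>" "1 < num_jordan_blocks (complex_mat A) z"
  shows "logarithms A \<approx> (UNIV :: real set)"
proof -
  \<comment> \<open>\<open>P\<close> is only known to contain the blocks in the upper half-plane;
    conjugation moves the eigenvalue there.\<close>
  obtain w where w: "0 < Im w" "1 < num_jordan_blocks (complex_mat A) w"
  proof (cases "0 < Im z")
    case False
    then have "0 < Im (cnj z)" using z(1) by (auto simp: complex_is_Real_iff)
    then show ?thesis using that[of "cnj z"] z(2) by (simp add: num_jordan_blocks_cnj)
  qed (use that z in blast)
  show ?thesis
  proof (rule logarithm_split[OF A])
    fix P R
    assume PR: "blocks A = P + image_mset cnj_block P + R"
      "R = filter_mset (\<lambda>b. snd b \<in> \<real> \<and> 0 < Re (snd b)) (blocks A)"
      "filter_mset (\<lambda>b. 0 < Im (snd b)) (blocks A) \<subseteq># P"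
      "\<And>b. b \<in># P \<Longrightarrow> snd b \<noteq> 0"
    let ?N = "filter_mset (\<lambda>b. snd b = w) (blocks A)"
    let ?\<mu> = "Ln w + 2 * of_int 1 * of_real pi * \<i>"
    have "?N \<subseteq># filter_mset (\<lambda>b. 0 < Im (snd b)) (blocks A)"
      unfolding subseteq_mset_def using w(1) by auto
    then have NP: "?N \<subseteq># P" using PR(3) by (rule subset_mset.order_trans)
    have "1 < size ?N" using w(2) unfolding num_jordan_blocks_def .
    then obtain b N1 where N1: "?N = add_mset b N1" "N1 \<noteq> {#}"
      by (metis One_nat_def Suc_lessD less_irrefl multiset_cases nonempty_has_size size_add_mset
          size_empty not_less_zero)
    then obtain c N2 where N2: "?N = {#b, c#} + N2" by (metis add_mset_add_single multiset_cases
          union_mset_add_mset_left add_mset_commute add.left_neutral)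
    have "b \<in># ?N" "c \<in># ?N" unfolding N2 by simp_all
    then have bc: "snd b = w" "snd c = w" by simp_all
    then obtain k l where kl: "b = (k, w)" "c = (l, w)" by (cases b, cases c) simp
    have "{#b, c#} \<subseteq># P" using NP N2 by (metis mset_subset_eq_add_left subset_mset.order_trans)
    then obtain P' where P': "P = {#b, c#} + P'" by (rule subseteq_mset_decompose)
    have "w \<noteq> 0" using w(1) by auto
    have exp_mu: "exp ?\<mu> = w" using \<open>w \<noteq> 0\<close> unfolding exp_plus_2pi_i by simp
    have "image_mset exp_block (image_mset Ln_block P') = P'"
      by (rule image_exp_Ln_block) (use PR(4) P' in simp)
    then have img: "image_mset exp_block ({#(k, Ln w), (l, ?\<mu>)#} + image_mset Ln_block P') = P"
      unfolding P' kl using exp_mu \<open>w \<noteq> 0\<close> by simp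
    have R: "snd b \<in> \<real> \<and> 0 < Re (snd b)" if "b \<in># R" for b
      using that unfolding PR(2) by simp
    show ?thesis
    proof (rule rexp_exists_split[OF PR(1) R img])
      fix X assume X: "rexp X 1 = A" "{#(k, Ln w), (l, ?\<mu>)#} + image_mset Ln_block P' \<subseteq># blocks X"
      have "(k, Ln w) \<in># blocks X" "(l, ?\<mu>) \<in># blocks X"
        by (rule mset_subset_eqD[OF X(2)], simp)+
      then have ev: "eigenvalue (complex_mat X) (Ln w)" "eigenvalue (complex_mat X) ?\<mu>"
        unfolding eigenvalue_iff_blocks by force+
      have "Ln w \<noteq> ?\<mu>" by simp
      moreover have "exp (Ln w) = exp ?\<mu>" unfolding exp_mu using \<open>w \<noteq> 0\<close> by simp
      ultimately show ?thesis
        unfolding X(1)[symmetric] using logarithms_continuum[OF ev] by blast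
    qed
  qed
qed

section \<open>Infinite, countable and one-element sets of logarithms\<close>

text \<open>This also covers a nonreal eigenvalue with a single block, where no two logarithms of it
  can occur in the same \<open>X\<close>. Each shift by \<open>2 m pi \<i>\<close> occurs in some
  \<open>X\<close>, but finitely many matrices have only finitely many eigenvalues.\<close>

lemma logarithms_infinite:
  fixes A :: "real^'n^'n"
  assumes A: "invertible A" "logarithms A \<noteq> {}"
    and z: "z \<notin> \<real>" "eigenvalue (complex_mat A) z"
  shows "infinite (logarithms A)"
proof
  assume fin: "finite (logarithms A)"
  obtain w where w: "0 < Im w" "eigenvalue (complex_mat A) w"
  proof (cases "0 < Im z")
    case False
    then have "0 < Im (cnj z)" using z(1) by (auto simp: complex_is_Real_iff)
    then show ?thesis using that[of "cnj z"] eigenvalue_cnj[OF z(2)] by blast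
  qed (use that z in blast)
  then obtain k where k: "(k, w) \<in># blocks A" unfolding eigenvalue_iff_blocks by auto
  let ?\<mu> = "\<lambda>m::int. Ln w + 2 * of_int m * of_real pi * \<i>"
  have "\<exists>X\<in>logarithms A. eigenvalue (complex_mat X) (?\<mu> m)" for m
  proof (rule logarithm_split[OF A])
    fix P R
    assume PR: "blocks A = P + image_mset cnj_block P + R"
      "R = filter_mset (\<lambda>b. snd b \<in> \<real> \<and> 0 < Re (snd b)) (blocks A)"
      "filter_mset (\<lambda>b. 0 < Im (snd b)) (blocks A) \<subseteq># P"
      "\<And>b. b \<in># P \<Longrightarrow> snd b \<noteq> 0"
    have "(k, w) \<in># P" by (rule mset_subset_eqD[OF PR(3)]) (use k w in simp)
    then obtain P' where P': "P = add_mset (k, w) P'" using multi_member_split by metis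
    have "w \<noteq> 0" using w(1) by auto
    have exp_mu: "exp (?\<mu> m) = w" using \<open>w \<noteq> 0\<close> unfolding exp_plus_2pi_i by simp
    have "image_mset exp_block (image_mset Ln_block P') = P'"
      by (rule image_exp_Ln_block) (use PR(4) P' in simp)
    then have img: "image_mset exp_block (add_mset (k, ?\<mu> m) (image_mset Ln_block P')) = P"
      unfolding P' using exp_mu by simp
    have R: "snd b \<in> \<real> \<and> 0 < Re (snd b)" if "b \<in># R" for b
      using that unfolding PR(2) by simp
    show ?thesis
    proof (rule rexp_exists_split[OF PR(1) R img])
      fix X assume X: "rexp X 1 = A" "add_mset (k, ?\<mu> m) (image_mset Ln_block P') \<subseteq># blocks X"
      have "(k, ?\<mu> m) \<in># blocks X" by (rule mset_subset_eqD[OF X(2)]) simp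
      then have "eigenvalue (complex_mat X) (?\<mu> m)" unfolding eigenvalue_iff_blocks by force
      then show ?thesis using X(1) by blast
    qed
  qed
  then have "range ?\<mu> \<subseteq> (\<Union>X\<in>logarithms A. {\<mu>. eigenvalue (complex_mat X) \<mu>})" by blast
  moreover have "finite (\<Union>X\<in>logarithms A. {\<mu>. eigenvalue (complex_mat X) \<mu>})"
    using fin finite_eigenvalues[OF complex_mat_carrier] by blast
  moreover have "infinite (range ?\<mu>)"
    by (simp add: finite_image_iff inj_def)
  ultimately show False using finite_subset by blast
qed

lemma logarithm_eq_if_eigenvalues_eq:
  fixes A :: "real^'n^'n"
  assumes pos: "\<And>x. eigenvalue (complex_mat A) (complex_of_real x) \<Longrightarrow>
      0 < x \<and> (\<forall>k. count (blocks A) (k, complex_of_real x) \<le> 1)"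
    and nonreal: "\<And>z. eigenvalue (complex_mat A) z \<Longrightarrow> z \<notin> \<real> \<Longrightarrow> num_jordan_blocks (complex_mat A) z \<le> 1"
    and X: "X \<in> logarithms A" and Y: "Y \<in> logarithms A"
    and eq: "{z. eigenvalue (complex_mat X) z} = {z. eigenvalue (complex_mat Y) z}"
  shows "X = Y"
proof -
  have A: "A = rexp X 1" using X by simp
  have inj: "inj_on exp {z. eigenvalue (complex_mat X) z}"
    by (rule inj_on_exp_eigenvalues) (use pos nonreal A in blast)+
  show ?thesis
    by (rule logarithm_unique[OF _ finite_eigenvalues[OF complex_mat_carrier] inj])
      (use X Y eq in auto)
qed

text \<open>The spectrum determines \<open>X\<close>, and it is a finite subset of the countable set
  \<open>?T\<close> of all logarithms of eigenvalues of \<open>A\<close>. Finite sets count as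
  \<open>countable\<close>; infinity is established separately.\<close>

lemma logarithms_countable:
  fixes A :: "real^'n^'n"
  assumes A: "invertible A"
    and pos: "\<And>x. eigenvalue (complex_mat A) (complex_of_real x) \<Longrightarrow>
      0 < x \<and> (\<forall>k. count (blocks A) (k, complex_of_real x) \<le> 1)"
    and nonreal: "\<And>z. eigenvalue (complex_mat A) z \<Longrightarrow> z \<notin> \<real> \<Longrightarrow> num_jordan_blocks (complex_mat A) z \<le> 1"
  shows "countable (logarithms A)"
proof -
  let ?spec = "\<lambda>X :: real^'n^'n. {z. eigenvalue (complex_mat X) z}"
  let ?T = "\<Union>z\<in>?spec A. range (\<lambda>m::int. Ln z + 2 * of_int m * of_real pi * \<i>)"
  have "inj_on ?spec (logarithms A)"
    by (rule inj_onI) (rule logarithm_eq_if_eigenvalues_eq[OF pos nonreal])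
  moreover have "?spec ` logarithms A \<subseteq> {F. finite F \<and> F \<subseteq> ?T}"
  proof safe
    fix X :: "real^'n^'n" and \<mu> assume X: "A = rexp X 1" and \<mu>: "eigenvalue (complex_mat X) \<mu>"
    have ev: "eigenvalue (complex_mat (rexp X 1)) (exp \<mu>)" by (rule exp_eigenvalue_rexp[OF \<mu>])
    have "exp (Ln (exp \<mu>)) = exp \<mu>" by simp
    then obtain m where "\<mu> = Ln (exp \<mu>) + 2 * of_int m * of_real pi * \<i>"
      using exp_eq[of \<mu> "Ln (exp \<mu>)"] by (auto simp: mult_ac)
    then show "\<mu> \<in> (\<Union>z\<in>?spec (rexp X 1). range (\<lambda>m::int. Ln z + 2 * of_int m * of_real pi * \<i>))"
      using ev by blast
  qed (rule finite_eigenvalues[OF complex_mat_carrier])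
  moreover have "countable ?T"
    by (rule countable_UN[OF countable_finite[OF finite_eigenvalues[OF complex_mat_carrier]]]) simp
  then have "countable {F. finite F \<and> F \<subseteq> ?T}" by (rule countable_Collect_finite_subset)
  ultimately show ?thesis by (meson countable_image_inj_on countable_subset)
qed

text \<open>Each logarithm has exactly the principal logarithms of the eigenvalues of
  \<open>A\<close> as its spectrum, so any two share it and agree.\<close>

lemma logarithms_unique:
  fixes A :: "real^'n^'n"
  assumes pos: "\<And>z. eigenvalue (complex_mat A) z \<Longrightarrow> z \<in> \<real> \<and> 0 < Re z"
    and mult: "\<And>z k. eigenvalue (complex_mat A) z \<Longrightarrow> count (blocks A) (k, z) \<le> 1"
    and X: "X \<in> logarithms A" and Y: "Y \<in> logarithms A"
  shows "X = Y"
proof -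
  have spec: "{z. eigenvalue (complex_mat X) z} = Ln ` {z. eigenvalue (complex_mat A) z}"
    if "X \<in> logarithms A" for X
  proof -
    have A: "A = rexp X 1" using that by simp
    have Ln: "\<mu> = Ln (exp \<mu>)" if "eigenvalue (complex_mat X) \<mu>" for \<mu>
    proof (rule real_log_eigenvalue[OF _ _ _ that])
      have ev: "eigenvalue (complex_mat A) (exp \<mu>)" unfolding A by (rule exp_eigenvalue_rexp[OF that])
      show "exp \<mu> \<in> \<real>" "0 < Re (exp \<mu>)" using pos[OF ev] by auto
      show "count (blocks (rexp X 1)) (k, exp \<mu>) \<le> 1" for k using mult[OF ev] unfolding A .
    qed
    show ?thesis
    proof safe
      fix \<mu> assume \<mu>: "eigenvalue (complex_mat X) \<mu>"
      then have "eigenvalue (complex_mat A) (exp \<mu>)" unfolding A by (rule exp_eigenvalue_rexp)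
      then show "\<mu> \<in> Ln ` {z. eigenvalue (complex_mat A) z}" using Ln[OF \<mu>] by blast
    next
      fix z assume "eigenvalue (complex_mat A) z"
      then obtain \<mu> where "eigenvalue (complex_mat X) \<mu>" "exp \<mu> = z"
          unfolding A by (rule eigenvalue_rexp)
      then show "eigenvalue (complex_mat X) (Ln z)" using Ln by metis
    qed
  qed
  show ?thesis
  proof (rule logarithm_eq_if_eigenvalues_eq[OF _ _ X Y])
    show "0 < x \<and> (\<forall>k. count (blocks A) (k, complex_of_real x) \<le> 1)"
      if "eigenvalue (complex_mat A) (complex_of_real x)" for x
      using pos[OF that] mult[OF that] by simp
    show "num_jordan_blocks (complex_mat A) z \<le> 1" if "eigenvalue (complex_mat A) z" "z \<notin> \<real>" for z
      using pos[OF that(1)] that(2) by simp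
  qed (simp only: spec[OF X] spec[OF Y])
qed

section \<open>From logarithms to geodesic arcs\<close>

theorem theorem2p2:
  fixes K0 K1 :: "real^'n^'n"
  assumes "K0 \<in> GL" and "K1 \<in> GL"
  shows
    "let M = complex_mat (matrix_inv K0 ** K1); S = geodesic_arcs K0 K1 in
     (S \<noteq> {} \<longleftrightarrow>
        (\<forall>x::real. x < 0 \<and> eigenvalue M (complex_of_real x) \<longrightarrow>
           (\<forall>k. even (jordan_multiplicity M k (complex_of_real x))))) \<and>
     ((\<exists>!\<gamma>. \<gamma> \<in> S) \<longleftrightarrow>
        (\<forall>z. eigenvalue M z \<longrightarrow> z \<in> \<real> \<and> 0 < Re z) \<and>
        (\<forall>z k. eigenvalue M z \<longrightarrow> jordan_multiplicity M k z \<le> 1)) \<and>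
     ((\<exists>\<gamma>\<in>S. \<exists>\<delta>\<in>S. \<gamma> \<noteq> \<delta>) \<longrightarrow>
        infinite S \<and>
        ((\<exists>z. eigenvalue M z \<and> z \<notin> \<real>) \<and>
         (\<forall>z. eigenvalue M z \<and> z \<notin> \<real> \<longrightarrow> \<not> num_jordan_blocks M z > 1) \<and>
         (\<forall>x::real. eigenvalue M (complex_of_real x) \<longrightarrow>
            0 < x \<and> (\<forall>k. jordan_multiplicity M k (complex_of_real x) \<le> 1))
         \<longrightarrow> countable S) \<and>
        ((\<exists>x::real. x < 0 \<and> eigenvalue M (complex_of_real x)) \<or>
         (\<exists>x::real. 0 < x \<and> eigenvalue M (complex_of_real x) \<and>
            (\<exists>k. jordan_multiplicity M k (complex_of_real x) > 1)) \<or>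
         (\<exists>z. eigenvalue M z \<and> z \<notin> \<real> \<and> num_jordan_blocks M z > 1)
         \<longrightarrow> uncountable S \<and> S \<approx> (UNIV :: real set)))"
proof -
  define A where "A = matrix_inv K0 ** K1"
  define M where "M = complex_mat A"
  define S where "S = geodesic_arcs K0 K1"
  define L where "L = logarithms A"
  have K: "invertible K0" "invertible K1" using assms by (auto simp: GL_def)
  then have "invertible (matrix_inv K0)" using matrix_inv_inverse[OF K(1)] unfolding invertible_def by blast
  then have A: "invertible A" unfolding A_def using K(2) by (rule invertible_mult)
  obtain f where f: "bij_betw f L S"
    using geodesic_arcs_bij[OF assms(1), of K1] unfolding L_def A_def S_def by blast
  then have LS: "L \<approx> S" unfolding eqpoll_def by blast
  have fS: "S = f ` L" using f by (simp add: bij_betw_def)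
  have mult: "jordan_multiplicity M k z = count (blocks A) (k, z)" for k z
    unfolding jordan_multiplicity_def M_def ..
  \<comment> \<open>A number that is no eigenvalue has multiplicity 0, which is even, so the parity
    condition may be restricted to eigenvalues.\<close>
  have zero: "count (blocks A) (k, z) = 0" if "\<not> eigenvalue M z" for k z
    using that unfolding M_def eigenvalue_iff_blocks by (force simp: not_in_iff)
  have nonempty: "L \<noteq> {} \<longleftrightarrow> (\<forall>x::real. x < 0 \<and> eigenvalue M (complex_of_real x) \<longrightarrow>
      (\<forall>k. even (jordan_multiplicity M k (complex_of_real x))))"
    unfolding L_def logarithms_nonempty_iff[OF A] mult
  proof (intro iffI allI impI)
    fix k and x :: real
    assume h: "\<forall>x. x < 0 \<and> eigenvalue M (complex_of_real x) \<longrightarrow>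
        (\<forall>k. even (count (blocks A) (k, complex_of_real x)))" and "x < 0"
    show "even (count (blocks A) (k, complex_of_real x))"
    proof (cases "eigenvalue M (complex_of_real x)")
      case True
      then show ?thesis using h \<open>x < 0\<close> by simp
    next
      case False
      from zero[OF this] show ?thesis by simp
    qed
  qed simp
  have continuum: "L \<approx> (UNIV :: real set)"
    if L: "L \<noteq> {}" and cases: "(\<exists>x::real. x < 0 \<and> eigenvalue M (complex_of_real x)) \<or>
        (\<exists>x::real. 0 < x \<and> eigenvalue M (complex_of_real x) \<and>
           (\<exists>k. jordan_multiplicity M k (complex_of_real x) > 1)) \<or>
        (\<exists>z. eigenvalue M z \<and> z \<notin> \<real> \<and> num_jordan_blocks M z > 1)"
    using cases unfolding L_def
  proof (elim disjE exE conjE)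
    fix x :: real assume x: "x < 0" "eigenvalue M (complex_of_real x)"
    obtain X where "X \<in> logarithms A" using L unfolding L_def by blast
    then show "logarithms A \<approx> (UNIV :: real set)"
      by (rule logarithms_continuum_negative[OF _ x[unfolded M_def]])
  next
    fix x :: real and k assume "0 < x" "1 < jordan_multiplicity M k (complex_of_real x)"
    then show "logarithms A \<approx> (UNIV :: real set)"
      unfolding mult by (rule logarithms_continuum_positive[OF A L[unfolded L_def]])
  next
    fix z assume "z \<notin> \<real>" "1 < num_jordan_blocks M z"
    then show "logarithms A \<approx> (UNIV :: real set)"
      unfolding M_def by (rule logarithms_continuum_nonreal[OF A L[unfolded L_def]])
  qed
  have uncount: "uncountable L" if "L \<approx> (UNIV :: real set)"
    using uncountable_UNIV_real countable_lepoll[OF _ eqpoll_imp_lepoll[OF eqpoll_sym[OF that]]] by blast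
  let ?good = "(\<forall>z. eigenvalue M z \<longrightarrow> z \<in> \<real> \<and> 0 < Re z) \<and>
      (\<forall>z k. eigenvalue M z \<longrightarrow> jordan_multiplicity M k z \<le> 1)"
  \<comment> \<open>If \<open>?good\<close> fails, either some eigenvalue is nonreal and its shifted
    logarithms suffice, or all are real and nonzero, and a negative one or a positive one with a
    repeated block gives the continuum.\<close>
  have inf: "infinite L" if L: "L \<noteq> {}" and bad: "\<not> ?good"
  proof (cases "\<exists>z. eigenvalue M z \<and> z \<notin> \<real>")
    case True
    then show ?thesis using logarithms_infinite[OF A] L unfolding L_def M_def by blast
  next
    case False
    obtain z where z: "eigenvalue M z" "\<not> 0 < Re z \<or> (\<exists>k. 1 < jordan_multiplicity M k z)"
      using bad False by (meson not_le)
    then obtain x where x: "z = complex_of_real x" using False by (auto simp: Reals_def)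
    have "z \<noteq> 0" using eigenvalue_complex_mat_nonzero[OF A] z(1) unfolding M_def by blast
    then have "x < 0 \<or> 0 < x \<and> (\<exists>k. 1 < jordan_multiplicity M k z)" using z(2) x by auto
    then have "L \<approx> (UNIV :: real set)" using continuum[OF L] z(1) x by blast
    then show ?thesis using uncount countable_finite by blast
  qed
  have singleton: "\<exists>X. L = {X}" if good: ?good
  proof -
    \<comment> \<open>Without negative eigenvalues the parity condition is void, so a logarithm
      exists.\<close>
    have "\<not> x < 0" if "eigenvalue M (complex_of_real x)" for x
      using good that by fastforce
    then have "L \<noteq> {}" unfolding nonempty by blast
    moreover have "X = Y" if "X \<in> L" "Y \<in> L" for X Y
      by (rule logarithms_unique[of A]) (use good that in \<open>auto simp: L_def M_def[symmetric] jordan_multiplicity_def\<close>)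
    ultimately show ?thesis by blast
  qed
  have empty_iff: "S = {} \<longleftrightarrow> L = {}" unfolding fS by simp
  have finite_iff: "finite S \<longleftrightarrow> finite L" using bij_betw_finite[OF f] by simp
  have countable_iff: "countable S \<longleftrightarrow> countable L"
    using countable_lepoll[OF _ eqpoll_imp_lepoll[OF LS]]
      countable_lepoll[OF _ eqpoll_imp_lepoll[OF eqpoll_sym[OF LS]]] by blast
  have ex1: "(\<exists>!\<gamma>. \<gamma> \<in> S) \<longleftrightarrow> ?good"
  proof
    assume "\<exists>!\<gamma>. \<gamma> \<in> S"
    then obtain \<gamma> where "S = {\<gamma>}" by blast
    then have "finite L" "L \<noteq> {}" using finite_iff empty_iff by auto
    then show ?good using inf by blast
  next
    assume ?good
    then obtain X where "L = {X}" using singleton by blast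
    then show "\<exists>!\<gamma>. \<gamma> \<in> S" unfolding fS by simp
  qed
  show ?thesis
    unfolding Let_def M_def[unfolded A_def, symmetric] S_def[symmetric]
  proof (intro conjI impI)
    show "S \<noteq> {} \<longleftrightarrow> (\<forall>x::real. x < 0 \<and> eigenvalue M (complex_of_real x) \<longrightarrow>
      (\<forall>k. even (jordan_multiplicity M k (complex_of_real x))))"
      unfolding empty_iff by (rule nonempty)
    show "(\<exists>!\<gamma>. \<gamma> \<in> S) \<longleftrightarrow> ?good" by (rule ex1)
  next
    assume two: "\<exists>\<gamma>\<in>S. \<exists>\<delta>\<in>S. \<gamma> \<noteq> \<delta>"
    then have L: "L \<noteq> {}" using empty_iff by blast
    \<comment> \<open>Two arcs contradict uniqueness, hence \<open>?good\<close>, and its failure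
      yields infinity without regard to the cases (a) and (b).\<close>
    have "\<not> ?good" using two ex1 by blast
    then show "infinite S" using inf[OF L] finite_iff by blast
    show "countable S"
      if h: "(\<exists>z. eigenvalue M z \<and> z \<notin> \<real>) \<and>
         (\<forall>z. eigenvalue M z \<and> z \<notin> \<real> \<longrightarrow> \<not> num_jordan_blocks M z > 1) \<and>
         (\<forall>x::real. eigenvalue M (complex_of_real x) \<longrightarrow>
            0 < x \<and> (\<forall>k. jordan_multiplicity M k (complex_of_real x) \<le> 1))"
      unfolding countable_iff L_def
      by (rule logarithms_countable[OF A]) (use h in \<open>auto simp: M_def[symmetric] jordan_multiplicity_def not_less\<close>)
    assume "(\<exists>x::real. x < 0 \<and> eigenvalue M (complex_of_real x)) \<or>
         (\<exists>x::real. 0 < x \<and> eigenvalue M (complex_of_real x) \<and>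
            (\<exists>k. jordan_multiplicity M k (complex_of_real x) > 1)) \<or>
         (\<exists>z. eigenvalue M z \<and> z \<notin> \<real> \<and> num_jordan_blocks M z > 1)"
    from continuum[OF L this] have c: "L \<approx> (UNIV :: real set)" .
    show "uncountable S" unfolding countable_iff by (rule uncount[OF c])
    show "S \<approx> (UNIV :: real set)" using eqpoll_trans[OF eqpoll_sym[OF LS] c] .
  qed
qed

end
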